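(* Let $D$ be an integral domain. If $D$ is rad-colon coherent, then $\mathrm{Over_{sloc}}(D)$, endowed with the subspace topology induced by the Zariski topology of $\mathrm{Over}(D)$, is a spectral space.
   Context: Let $K$ be the quotient field of $D$. A spectral space is a topological space homeomorphic to the prime spectrum of a commutative unitary ring with the Zariski topology. An overring of $D$ is a ring $T$ with $D\subseteq T\subseteq K$; $\mathrm{Over}(D)$ is the set of all overrings of $D$, endowed with the Zariski topology, which has as a basis of open sets the sets $\mathcal{B}(x_1,\ldots,x_n):=\{T\in\mathrm{Over}(D)\mid x_1,\ldots,x_n\in T\}$, as $x_1,\ldots,x_n$ range in $K$. A sublocalization of $D$ is an overring that is an intersection of localizations of $D$ at prime ideals, i.e. of the form $\bigcap\{D_P\mid P\in\Delta\}$ for some $\Delta\subseteq\mathrm{Spec}(D)$; $\mathrm{Over_{sloc}}(D)$ is the set of all sublocalizations of $D$. For $x\in K$, $(D:_Dx):=\{d\in D\mid dx\in D\}$. The domain $D$ is rad-colon coherent if, for every $x\in K\setminus D$, there is a finitely generated ideal $I$ of $D$ such that $\mathrm{rad}(I)=\mathrm{rad}((D:_Dx))$. *)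

theory Defs
  imports
    "HOL-Analysis.Abstract_Topology"
    "HOL-Algebra.Ideal"
    "HOL-Algebra.Subrings"
begin

section \<open>The prime spectrum and spectral spaces\<close>

definition prime_spectrum :: "('a, 'b) ring_scheme \<Rightarrow> 'a set set" where
  "prime_spectrum R = {P. primeideal P R}"

definition zariski_spec :: "('a, 'b) ring_scheme \<Rightarrow> 'a set topology" where
  "zariski_spec R =
     topology (\<lambda>U. \<exists>S \<subseteq> carrier R. U = prime_spectrum R - {P \<in> prime_spectrum R. S \<subseteq> P})"

lemma istopology_zariski_spec:
  "istopology (\<lambda>U. \<exists>S \<subseteq> carrier R. U = prime_spectrum R - {P \<in> prime_spectrum R. S \<subseteq> P})"
  (is "istopology ?L")
  unfolding istopology_def
proof (intro conjI allI impI)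
  fix U V assume "?L U" "?L V"
  then obtain S T where S: "S \<subseteq> carrier R" "U = prime_spectrum R - {P \<in> prime_spectrum R. S \<subseteq> P}"
    and T: "T \<subseteq> carrier R" "V = prime_spectrum R - {P \<in> prime_spectrum R. T \<subseteq> P}"
    by blast
  show "?L (U \<inter> V)"
  proof (cases "prime_spectrum R = {}")
    case True
    then show ?thesis using S T by blast
  next
    case False
    then obtain P0 where "primeideal P0 R"
      by (auto simp: prime_spectrum_def)
    then interpret cring R
      by (simp add: primeideal_def)
    let ?W = "{s \<otimes>\<^bsub>R\<^esub> t | s t. s \<in> S \<and> t \<in> T}"
    have "?W \<subseteq> carrier R" using S(1) T(1) by blast
    moreover have "?W \<subseteq> P \<longleftrightarrow> S \<subseteq> P \<or> T \<subseteq> P" if "primeideal P R" for P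
    proof -
      interpret P: primeideal P R by fact
      have "s \<otimes>\<^bsub>R\<^esub> t \<in> P" if "s \<in> S" "t \<in> T" "S \<subseteq> P \<or> T \<subseteq> P" for s t
        using that P.I_l_closed[of t s] P.I_r_closed[of s t] S(1) T(1) by auto
      moreover have "T \<subseteq> P" if "?W \<subseteq> P" "s \<in> S" "s \<notin> P" for s
      proof
        fix t assume "t \<in> T"
        then have "s \<otimes>\<^bsub>R\<^esub> t \<in> P" using that(1,2) by blast
        then show "t \<in> P" using P.I_prime[of s t] that(2,3) \<open>t \<in> T\<close> S(1) T(1) by auto
      qed
      ultimately show ?thesis by auto
    qed
    moreover from this have "U \<inter> V = prime_spectrum R - {P \<in> prime_spectrum R. ?W \<subseteq> P}"
      unfolding S(2) T(2) prime_spectrum_def by blast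
    ultimately show ?thesis by blast
  qed
next
  fix \<K> assume "\<forall>U\<in>\<K>. ?L U"
  then have "\<forall>U\<in>\<K>. \<exists>S. S \<subseteq> carrier R \<and> U = prime_spectrum R - {P \<in> prime_spectrum R. S \<subseteq> P}"
    by simp
  from bchoice[OF this] obtain S where "\<forall>U\<in>\<K>. S U \<subseteq> carrier R \<and>
    U = prime_spectrum R - {P \<in> prime_spectrum R. S U \<subseteq> P}" by (elim exE)
  then have S: "\<And>U. U \<in> \<K> \<Longrightarrow> S U \<subseteq> carrier R"
    and mem: "\<And>U P. U \<in> \<K> \<Longrightarrow> P \<in> U \<longleftrightarrow> P \<in> prime_spectrum R \<and> \<not> S U \<subseteq> P"
    by (blast, blast)
  have "\<Union>\<K> = prime_spectrum R - {P \<in> prime_spectrum R. (\<Union>U\<in>\<K>. S U) \<subseteq> P}"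
    by (simp add: set_eq_iff UN_subset_iff mem cong: bex_cong) blast
  then show "?L (\<Union>\<K>)"
    using S by (intro exI[of _ "\<Union>U\<in>\<K>. S U"] conjI) (simp_all add: UN_subset_iff)
qed

lemma openin_zariski_spec:
  "openin (zariski_spec R) U \<longleftrightarrow>
     (\<exists>S \<subseteq> carrier R. U = prime_spectrum R - {P \<in> prime_spectrum R. S \<subseteq> P})"
  unfolding zariski_spec_def topology_inverse'[OF istopology_zariski_spec] ..

text \<open>
  HOL cannot quantify over the type that carries the witnessing ring, so a type that is large enough
  for every space with points in \<open>'x\<close> is fixed. This loses no spectral space: \<open>(nat \<times> 'x) set\<close> has
  \<open>2 ^ max(|'x|, \<aleph>0)\<close> elements, a spectral space with points in \<open>'x\<close> has at most \<open>2 ^ |'x|\<close>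
  compact open sets, and Hochster's construction gives a ring generated, over a countable field,
  by operations on elements indexed by these sets.
\<close>

definition spectral_space :: "'x topology \<Rightarrow> bool" where
  "spectral_space X \<longleftrightarrow>
     (\<exists>R :: ((nat \<times> 'x) set) ring. cring R \<and> X homeomorphic_space zariski_spec R)"


section \<open>Domains, overrings and sublocalizations\<close>

text \<open>
  A domain \<open>D\<close> is given as a subset of (the carrier of) its quotient field \<open>K\<close>;
  as a ring it is \<open>K\<lparr>carrier := D\<rparr>\<close>.
\<close>

definition is_quotient_field :: "('a, 'b) ring_scheme \<Rightarrow> 'a set \<Rightarrow> bool" where
  "is_quotient_field K D \<longleftrightarrow> field K \<and> subdomain D K \<and>
     (\<forall>x \<in> carrier K. \<exists>a \<in> D. \<exists>b \<in> D - {\<zero>\<^bsub>K\<^esub>}. x = a \<otimes>\<^bsub>K\<^esub> inv\<^bsub>K\<^esub> b)"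

definition overrings :: "('a, 'b) ring_scheme \<Rightarrow> 'a set \<Rightarrow> 'a set set" where
  "overrings K D = {T. subring T K \<and> D \<subseteq> T}"

definition overring_basic :: "('a, 'b) ring_scheme \<Rightarrow> 'a set \<Rightarrow> 'a set \<Rightarrow> 'a set set" where
  "overring_basic K D F = {T \<in> overrings K D. F \<subseteq> T}"

definition zariski_over :: "('a, 'b) ring_scheme \<Rightarrow> 'a set \<Rightarrow> 'a set topology" where
  "zariski_over K D = topology (arbitrary union_of
     (\<lambda>U. \<exists>F. finite F \<and> F \<subseteq> carrier K \<and> U = overring_basic K D F))"

lemma openin_zariski_over:
  "openin (zariski_over K D) = arbitrary union_of
     (\<lambda>U. \<exists>F. finite F \<and> F \<subseteq> carrier K \<and> U = overring_basic K D F)"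
  unfolding zariski_over_def
proof (intro topology_inverse' istopology_base)
  fix U V
  assume "\<exists>F. finite F \<and> F \<subseteq> carrier K \<and> U = overring_basic K D F"
    and "\<exists>F. finite F \<and> F \<subseteq> carrier K \<and> V = overring_basic K D F"
  then obtain F G where "finite F" "F \<subseteq> carrier K" "U = overring_basic K D F"
    "finite G" "G \<subseteq> carrier K" "V = overring_basic K D G"
    by blast
  then show "\<exists>F. finite F \<and> F \<subseteq> carrier K \<and> U \<inter> V = overring_basic K D F"
    by (intro exI[of _ "F \<union> G"]) (auto simp: overring_basic_def)
qed

lemma topspace_zariski_over: "topspace (zariski_over K D) = overrings K D"
proof
  show "topspace (zariski_over K D) \<subseteq> overrings K D"
    unfolding topspace_def openin_zariski_over union_of_def overring_basic_def by blast
  have "openin (zariski_over K D) (overring_basic K D {})"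
    unfolding openin_zariski_over by (rule arbitrary_union_of_inc) blast
  then show "overrings K D \<subseteq> topspace (zariski_over K D)"
    by (auto dest!: openin_subset simp: overring_basic_def)
qed

definition localization_at :: "('a, 'b) ring_scheme \<Rightarrow> 'a set \<Rightarrow> 'a set \<Rightarrow> 'a set" where
  "localization_at K D P = {a \<otimes>\<^bsub>K\<^esub> inv\<^bsub>K\<^esub> s | a s. a \<in> D \<and> s \<in> D - P}"

text \<open>
  Intersecting with \<open>carrier K\<close> only matters for \<open>\<Delta> = {}\<close>, where the intersection is taken to be
  \<open>K\<close>, which is also the localization of \<open>D\<close> at the zero ideal.
\<close>

definition sublocalizations :: "('a, 'b) ring_scheme \<Rightarrow> 'a set \<Rightarrow> 'a set set" where
  "sublocalizations K D = {T \<in> overrings K D.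
     \<exists>\<Delta> \<subseteq> prime_spectrum (K\<lparr>carrier := D\<rparr>). T = carrier K \<inter> (\<Inter>P\<in>\<Delta>. localization_at K D P)}"


section \<open>Rad-colon coherence\<close>

definition radical :: "('a, 'b) ring_scheme \<Rightarrow> 'a set \<Rightarrow> 'a set" where
  "radical R I = {a \<in> carrier R. \<exists>n::nat. n > 0 \<and> a [^]\<^bsub>R\<^esub> n \<in> I}"

definition finitely_generated_ideal :: "('a, 'b) ring_scheme \<Rightarrow> 'a set \<Rightarrow> bool" where
  "finitely_generated_ideal R I \<longleftrightarrow> (\<exists>S. finite S \<and> S \<subseteq> carrier R \<and> I = genideal R S)"

definition colon_ideal :: "('a, 'b) ring_scheme \<Rightarrow> 'a set \<Rightarrow> 'a \<Rightarrow> 'a set" where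
  "colon_ideal K D x = {d \<in> D. d \<otimes>\<^bsub>K\<^esub> x \<in> D}"

definition rad_colon_coherent :: "('a, 'b) ring_scheme \<Rightarrow> 'a set \<Rightarrow> bool" where
  "rad_colon_coherent K D \<longleftrightarrow> (\<forall>x \<in> carrier K - D. \<exists>I.
     finitely_generated_ideal (K\<lparr>carrier := D\<rparr>) I \<and>
     radical (K\<lparr>carrier := D\<rparr>) I = radical (K\<lparr>carrier := D\<rparr>) (colon_ideal K D x))"

end

theory Submission
  imports
    Defs
    "HOL-Computational_Algebra.Fraction_Field"
    "HOL-Computational_Algebra.Polynomial"
    "HOL-Algebra.Weak_Morphisms"
begin

text \<open>
  Two facts combine. The first is about \<open>D\<close>: under rad-colon coherence the sublocalizations form an
  \<^emph>\<open>algebraic closure system\<close> on \<open>K\<close>, that is, they are closed under intersections and a set is a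
  sublocalization as soon as it contains the closure of each of its finite subsets. Indeed, an
  element \<open>x\<close> of \<open>K\<close> lies in \<open>D\<^sub>P\<close> iff the colon ideal of \<open>x\<close> is not inside \<open>P\<close>, and rad-colon
  coherence makes this a condition on finitely many elements of \<open>D\<close>. Such conditions survive
  ultraproducts of primes, so primes that work for the finite subsets of \<open>T\<close> can be merged into one
  that works for \<open>T\<close> (\<open>finitary_sublocalizations\<close>).

  The second fact is that every algebraic closure system \<open>X\<close>, with the topology generated by the sets
  \<open>{T \<in> X. F \<subseteq> T}\<close> for finite \<open>F\<close>, is a spectral space (\<open>algebraic_closure_system.spectral\<close>). A ring
  with spectrum \<open>X\<close> is written down directly. Take an indeterminate \<open>t\<^sub>x\<close> for every point \<open>x\<close>. For a
  set \<open>T\<close>, a rational function \<open>f\<close> \<^emph>\<open>specializes\<close> along \<open>T\<close> to \<open>c\<close> if it tends to \<open>c\<close> when the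
  indeterminates outside \<open>T\<close> are scaled down to \<open>0\<close>. The elements of the ring are the families \<open>f\<close>
  of rational functions, indexed by \<open>T \<in> X\<close>, such that \<open>f T\<close> depends only on the trace of \<open>T\<close> on a
  finite set and \<open>f T'\<close> specializes along \<open>T\<close> to \<open>f T\<close> whenever \<open>T \<subseteq> T'\<close>. Evaluation at \<open>T\<close> has a
  prime kernel, and every prime is such a kernel, for the following reasons.

  \<^item> The support of a family is a finite union of sets \<open>{T \<in> X. F \<subseteq> T}\<close> (\<open>support_is_finite_union\<close>).
    It is closed upwards because \<open>f T' = 0\<close> forces \<open>f T = 0\<close> for \<open>T \<subseteq> T'\<close>, and finite determination
    lets \<open>T\<close> be replaced by the closure of a finite set.
  \<^item> If \<open>g\<close> vanishes wherever \<open>f\<close> does, then \<open>f\<close> divides a power of \<open>g\<close> (\<open>coherent_divides_power\<close>):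
    the quotients \<open>g T ^ n / f T\<close> are again coherent for large \<open>n\<close>, because under specialization a
    nonzero \<open>f T'\<close> vanishes at most to a bounded order, and \<open>g T'\<close>, if it vanishes, at least to order
    one. So the support of \<open>f\<close> decides whether \<open>f\<close> lies in a prime \<open>Q\<close>, and \<open>Q\<close> turns out to be the
    kernel at \<open>T = {x. t\<^sub>x \<notin> Q}\<close> (\<open>prime_is_kernel\<close>).

  A family is determined by its value at the largest member of \<open>X\<close>, and rational functions are coded
  by pairs of expressions; this moves the ring to the type demanded by the definition of a spectral
  space.
\<close>

section \<open>Polynomial functions and rational functions at generic points\<close>

text \<open>
  Polynomials with integer coefficients in arbitrarily many indeterminates are represented by the
  functions they induce on real points, which is faithful in characteristic zero. The generating
  expressions are kept as a datatype because they also provide the codes needed at the end.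
\<close>

datatype 'v pexpr = Minus_One | Var 'v | Plus "'v pexpr" "'v pexpr" | Times "'v pexpr" "'v pexpr"

primrec peval :: "'v pexpr \<Rightarrow> ('v \<Rightarrow> real) \<Rightarrow> real" where
  "peval Minus_One t = - 1"
| "peval (Var x) t = t x"
| "peval (Plus a b) t = peval a t + peval b t"
| "peval (Times a b) t = peval a t * peval b t"

typedef 'v polyfun = "range (peval :: 'v pexpr \<Rightarrow> ('v \<Rightarrow> real) \<Rightarrow> real)"
  morphisms papp Abs_polyfun
  by blast

setup_lifting type_definition_polyfun

text \<open>
  The degree bound does not depend on the line. This uniformity is what later bounds, for all sets at
  once, the order to which a fixed polynomial can vanish under specialization.
\<close>

lemma peval_line:
  "\<exists>N. \<forall>a b. \<exists>P :: real poly. degree P \<le> N \<and> (\<forall>\<epsilon>. poly P \<epsilon> = peval e (\<lambda>x. a x + \<epsilon> * b x))"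
proof (induction e)
  case Minus_One
  show ?case by (rule exI[of _ 0], intro allI, rule exI[of _ "[:- 1:]"]) simp
next
  case (Var x)
  show ?case
    by (rule exI[of _ 1], intro allI, rule_tac x = "[:a x, b x:]" in exI) simp
next
  case (Plus e1 e2)
  then obtain N1 N2
    where N: "\<forall>a b. \<exists>P :: real poly. degree P \<le> N1 \<and> (\<forall>\<epsilon>. poly P \<epsilon> = peval e1 (\<lambda>x. a x + \<epsilon> * b x))"
      "\<forall>a b. \<exists>P :: real poly. degree P \<le> N2 \<and> (\<forall>\<epsilon>. poly P \<epsilon> = peval e2 (\<lambda>x. a x + \<epsilon> * b x))"
    by blast
  show ?case
  proof (intro exI[of _ "max N1 N2"] allI)
    fix a b
    obtain P Q :: "real poly" where "degree P \<le> N1" "\<forall>\<epsilon>. poly P \<epsilon> = peval e1 (\<lambda>x. a x + \<epsilon> * b x)"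
      "degree Q \<le> N2" "\<forall>\<epsilon>. poly Q \<epsilon> = peval e2 (\<lambda>x. a x + \<epsilon> * b x)"
      using N by meson
    then show "\<exists>P :: real poly. degree P \<le> max N1 N2 \<and>
        (\<forall>\<epsilon>. poly P \<epsilon> = peval (Plus e1 e2) (\<lambda>x. a x + \<epsilon> * b x))"
      by (intro exI[of _ "P + Q"]) (auto intro: degree_add_le)
  qed
next
  case (Times e1 e2)
  then obtain N1 N2
    where N: "\<forall>a b. \<exists>P :: real poly. degree P \<le> N1 \<and> (\<forall>\<epsilon>. poly P \<epsilon> = peval e1 (\<lambda>x. a x + \<epsilon> * b x))"
      "\<forall>a b. \<exists>P :: real poly. degree P \<le> N2 \<and> (\<forall>\<epsilon>. poly P \<epsilon> = peval e2 (\<lambda>x. a x + \<epsilon> * b x))"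
    by blast
  show ?case
  proof (intro exI[of _ "N1 + N2"] allI)
    fix a b
    obtain P Q :: "real poly" where "degree P \<le> N1" "\<forall>\<epsilon>. poly P \<epsilon> = peval e1 (\<lambda>x. a x + \<epsilon> * b x)"
      "degree Q \<le> N2" "\<forall>\<epsilon>. poly Q \<epsilon> = peval e2 (\<lambda>x. a x + \<epsilon> * b x)"
      using N by meson
    then show "\<exists>P :: real poly. degree P \<le> N1 + N2 \<and>
        (\<forall>\<epsilon>. poly P \<epsilon> = peval (Times e1 e2) (\<lambda>x. a x + \<epsilon> * b x))"
      by (intro exI[of _ "P * Q"]) (auto intro: order_trans[OF degree_mult_le])
  qed
qed

lemma papp_line:
  "\<exists>N. \<forall>a b. \<exists>P :: real poly. degree P \<le> N \<and> (\<forall>\<epsilon>. poly P \<epsilon> = papp p (\<lambda>x. a x + \<epsilon> * b x))"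
proof -
  obtain e where "papp p = peval e"
    using papp[of p] by auto
  then show ?thesis using peval_line[of e] by simp
qed

instantiation polyfun :: (type) comm_ring_1
begin

lift_definition zero_polyfun :: "'v polyfun" is "\<lambda>t. 0"
  by (rule image_eqI[of _ _ "Plus Minus_One (Times Minus_One Minus_One)"]) auto

lift_definition one_polyfun :: "'v polyfun" is "\<lambda>t. 1"
  by (rule image_eqI[of _ _ "Times Minus_One Minus_One"]) auto

lift_definition uminus_polyfun :: "'v polyfun \<Rightarrow> 'v polyfun" is "\<lambda>f t. - f t"
  by (clarify, rule_tac x = "Times Minus_One x" in image_eqI) auto

lift_definition plus_polyfun :: "'v polyfun \<Rightarrow> 'v polyfun \<Rightarrow> 'v polyfun" is "\<lambda>f g t. f t + g t"
  by (clarify, rule_tac x = "Plus x xa" in image_eqI) auto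

lift_definition minus_polyfun :: "'v polyfun \<Rightarrow> 'v polyfun \<Rightarrow> 'v polyfun" is "\<lambda>f g t. f t - g t"
  by (clarify, rule_tac x = "Plus x (Times Minus_One xa)" in image_eqI) auto

lift_definition times_polyfun :: "'v polyfun \<Rightarrow> 'v polyfun \<Rightarrow> 'v polyfun" is "\<lambda>f g t. f t * g t"
  by (clarify, rule_tac x = "Times x xa" in image_eqI) auto

instance
  by standard (transfer; simp add: algebra_simps fun_eq_iff)+

end

lift_definition pvar :: "'v \<Rightarrow> 'v polyfun" is "\<lambda>x t. t x"
proof -
  fix x :: 'v
  show "(\<lambda>t. t x) \<in> range peval"
    by (rule image_eqI[of _ _ "Var x"]) auto
qed

lemmas papp_simps [simp] = zero_polyfun.rep_eq one_polyfun.rep_eq uminus_polyfun.rep_eq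
  plus_polyfun.rep_eq minus_polyfun.rep_eq times_polyfun.rep_eq pvar.rep_eq

lemma polyfun_eqI: "(\<And>t. papp p t = papp q t) \<Longrightarrow> p = q"
  by (simp add: papp_inject[symmetric] fun_eq_iff)

text \<open>
  Joining a nonzero of one factor to a nonzero of the other by a line reduces the absence of zero
  divisors to univariate real polynomials.
\<close>

instance polyfun :: (type) idom
proof
  fix p q :: "'a polyfun"
  assume "p \<noteq> 0" "q \<noteq> 0"
  then obtain s u where su: "papp p s \<noteq> 0" "papp q u \<noteq> 0"
    by (metis polyfun_eqI zero_polyfun.rep_eq)
  obtain P :: "real poly" where P: "\<And>\<epsilon>. poly P \<epsilon> = papp p (\<lambda>x. s x + \<epsilon> * (u x - s x))"
    using papp_line[of p] by meson
  obtain Q :: "real poly" where Q: "\<And>\<epsilon>. poly Q \<epsilon> = papp q (\<lambda>x. s x + \<epsilon> * (u x - s x))"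
    using papp_line[of q] by meson
  have "poly P 0 \<noteq> 0" "poly Q 1 \<noteq> 0"
    using su by (simp_all add: P Q)
  then have "P * Q \<noteq> 0" by auto
  then obtain \<epsilon> where "poly (P * Q) \<epsilon> \<noteq> 0"
    by (meson poly_all_0_iff_0)
  then have "papp (p * q) (\<lambda>x. s x + \<epsilon> * (u x - s x)) \<noteq> 0"
    by (simp add: P Q)
  then show "p * q \<noteq> 0"
    by (metis zero_polyfun.rep_eq)
qed

text \<open>
  The filter generated by the nonempty principal Zariski open sets: statements about rational
  functions are made at points where some fixed nonzero polynomial does not vanish. Such statements
  can be combined because nonzero polynomials have a nonzero product.
\<close>

definition generic :: "('v \<Rightarrow> real) filter" where
  "generic = (INF r\<in>- {0}. principal {t. papp r t \<noteq> 0})"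

lemma eventually_generic:
  "eventually P generic \<longleftrightarrow> (\<exists>r. r \<noteq> 0 \<and> (\<forall>t. papp r t \<noteq> 0 \<longrightarrow> P t))"
proof -
  have "eventually P generic \<longleftrightarrow> (\<exists>r\<in>- {0}. eventually P (principal {t. papp r t \<noteq> 0}))"
    unfolding generic_def
  proof (rule eventually_INF_base)
    show "- {0 :: 'a polyfun} \<noteq> {}"
      using zero_neq_one[where ?'a = "'a polyfun"] by (metis ComplI empty_iff singletonD)
  next
    fix a b :: "'a polyfun" assume "a \<in> - {0}" "b \<in> - {0}"
    then show "\<exists>x\<in>- {0}. principal {t. papp x t \<noteq> 0} \<le>
        inf (principal {t. papp a t \<noteq> 0}) (principal {t. papp b t \<noteq> 0})"
      by (intro bexI[of _ "a * b"]) auto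
  qed
  then show ?thesis by (auto simp: eventually_principal)
qed

lemma papp_generic_nonzero: "r \<noteq> 0 \<Longrightarrow> \<forall>\<^sub>F t in generic. papp r t \<noteq> 0"
  by (auto simp: eventually_generic)

text \<open>
  The value depends on the chosen representative, but only outside a generic set of points.
\<close>

definition fapp :: "'v polyfun fract \<Rightarrow> ('v \<Rightarrow> real) \<Rightarrow> real" where
  "fapp f t = (let (p, q) = (SOME (p, q). q \<noteq> 0 \<and> f = Fract p q) in papp p t / papp q t)"

lemma fapp_Fract:
  assumes "q \<noteq> 0"
  shows "\<forall>\<^sub>F t in generic. fapp (Fract p q) t = papp p t / papp q t"
proof -
  define pq where "pq = (SOME (a, b). b \<noteq> 0 \<and> Fract p q = Fract a b)"
  have "case pq of (a, b) \<Rightarrow> b \<noteq> 0 \<and> Fract p q = Fract a b"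
    unfolding pq_def by (rule someI[of _ "(p, q)"]) (use assms in auto)
  then obtain a b where ab: "pq = (a, b)" "b \<noteq> 0" "Fract p q = Fract a b"
    by (cases pq) auto
  then have eq: "p * b = a * q"
    using assms by (simp add: eq_fract)
  have fapp: "fapp (Fract p q) t = papp a t / papp b t" for t
    unfolding fapp_def pq_def[symmetric] by (simp add: ab)
  have cross: "papp p t * papp b t = papp a t * papp q t" for t
    using arg_cong[OF eq, of "\<lambda>r. papp r t"] by simp
  show ?thesis
    using papp_generic_nonzero[OF assms] papp_generic_nonzero[OF ab(2)]
    by eventually_elim (simp add: fapp cross frac_eq_eq)
qed

lemma fapp_add: "\<forall>\<^sub>F t in generic. fapp (f + g) t = fapp f t + fapp g t"
proof (cases f, cases g)
  fix p q r s assume *: "f = Fract p q" "g = Fract r s" "q \<noteq> 0" "s \<noteq> 0"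
  have "f + g = Fract (p * s + r * q) (q * s)" using * by simp
  have "q * s \<noteq> 0" using * by simp
  from fapp_Fract[OF this, of "p * s + r * q"] fapp_Fract[OF *(3), of p] fapp_Fract[OF *(4), of r]
    papp_generic_nonzero[OF *(3)] papp_generic_nonzero[OF *(4)]
  show ?thesis
    unfolding \<open>f + g = _\<close> unfolding * by eventually_elim (simp add: add_frac_eq)
qed

lemma fapp_mult: "\<forall>\<^sub>F t in generic. fapp (f * g) t = fapp f t * fapp g t"
proof (cases f, cases g)
  fix p q r s assume *: "f = Fract p q" "g = Fract r s" "q \<noteq> 0" "s \<noteq> 0"
  have "f * g = Fract (p * r) (q * s)" using * by simp
  have "q * s \<noteq> 0" using * by simp
  from fapp_Fract[OF this, of "p * r"] fapp_Fract[OF *(3), of p] fapp_Fract[OF *(4), of r]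
  show ?thesis
    unfolding \<open>f * g = _\<close> unfolding * by eventually_elim simp
qed

lemma fapp_poly: "\<forall>\<^sub>F t in generic. fapp (Fract p 1) t = papp p t"
  using fapp_Fract[of 1 p] by simp

lemma fapp_eq_iff: "(\<forall>\<^sub>F t in generic. fapp f t = fapp g t) \<longleftrightarrow> f = g"
proof
  assume eq: "\<forall>\<^sub>F t in generic. fapp f t = fapp g t"
  show "f = g"
  proof (cases f, cases g)
    fix p q r s assume *: "f = Fract p q" "g = Fract r s" "q \<noteq> 0" "s \<noteq> 0"
    have "\<forall>\<^sub>F t in generic. papp (p * s - r * q) t = 0"
      using eq fapp_Fract[OF *(3), of p] fapp_Fract[OF *(4), of r] papp_generic_nonzero[OF *(3)]
        papp_generic_nonzero[OF *(4)] unfolding * by eventually_elim (simp add: frac_eq_eq)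
    then obtain u where "u \<noteq> 0" and u: "\<And>t. papp u t \<noteq> 0 \<Longrightarrow> papp (p * s - r * q) t = 0"
      by (auto simp: eventually_generic)
    have "u * (p * s - r * q) = 0"
      by (rule polyfun_eqI) (use u in force)
    then show ?thesis
      using * \<open>u \<noteq> 0\<close> by (simp add: eq_fract)
  qed
qed simp

lemma fapp_0: "\<forall>\<^sub>F t in generic. fapp 0 t = 0"
  using fapp_poly[of 0] by (simp add: Zero_fract_def)

lemma fapp_1: "\<forall>\<^sub>F t in generic. fapp 1 t = 1"
  using fapp_poly[of 1] by (simp add: One_fract_def)

lemma fapp_nonzero:
  assumes "f \<noteq> 0"
  shows "\<forall>\<^sub>F t in generic. fapp f t \<noteq> 0"
proof -
  have "f * inverse f = 1" using assms by simp
  with fapp_mult[of f "inverse f"] have "\<forall>\<^sub>F t in generic. fapp 1 t = fapp f t * fapp (inverse f) t"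
    by simp
  with fapp_1 show ?thesis by eventually_elim auto
qed

lemma fapp_divide: 
  assumes "g \<noteq> 0"
  shows "\<forall>\<^sub>F t in generic. fapp (f / g) t = fapp f t / fapp g t"
proof -
  have "f / g * g = f" using assms by simp
  with fapp_mult[of "f / g" g] have "\<forall>\<^sub>F t in generic. fapp f t = fapp (f / g) t * fapp g t"
    by simp
  with fapp_nonzero[OF assms] show ?thesis by eventually_elim simp
qed

lemma fapp_uminus: "\<forall>\<^sub>F t in generic. fapp (- f) t = - fapp f t"
proof -
  from fapp_add[of f "- f"] have "\<forall>\<^sub>F t in generic. fapp 0 t = fapp f t + fapp (- f) t"
    by simp
  with fapp_0 show ?thesis by eventually_elim simp
qed

lemma fapp_power: "\<forall>\<^sub>F t in generic. fapp (f ^ n) t = fapp f t ^ n"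
proof (induction n)
  case 0
  then show ?case using fapp_1 by simp
next
  case (Suc n)
  with fapp_mult[of f "f ^ n"] show ?case unfolding power_Suc by eventually_elim simp
qed

section \<open>Specialization of rational functions\<close>

text \<open>
  Scaling the coordinates outside \<open>T\<close> by \<open>\<epsilon>\<close>; letting \<open>\<epsilon>\<close> tend to \<open>0\<close> moves a point to the
  coordinate subspace of \<open>T\<close>.
\<close>

definition shrink :: "'v set \<Rightarrow> real \<Rightarrow> ('v \<Rightarrow> real) \<Rightarrow> 'v \<Rightarrow> real" where
  "shrink T \<epsilon> t x = (if x \<in> T then t x else \<epsilon> * t x)"

lemma papp_shrink:
  "\<exists>N. \<forall>T t. \<exists>P :: real poly. degree P \<le> N \<and> (\<forall>\<epsilon>. poly P \<epsilon> = papp p (shrink T \<epsilon> t))"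
proof -
  obtain N where N: "\<forall>a b. \<exists>P :: real poly. degree P \<le> N \<and> (\<forall>\<epsilon>. poly P \<epsilon> = papp p (\<lambda>x. a x + \<epsilon> * b x))"
    using papp_line by blast
  have *: "shrink T \<epsilon> t = (\<lambda>x. (if x \<in> T then t x else 0) + \<epsilon> * (if x \<in> T then 0 else t x))" for T \<epsilon> t
    by (auto simp: shrink_def fun_eq_iff)
  show ?thesis
    using N unfolding * by (intro exI[of _ N] allI) (erule allE, erule allE)
qed

lemma eventually_poly_nonzero:
  fixes P :: "real poly"
  assumes "P \<noteq> 0"
  shows "\<forall>\<^sub>F \<epsilon> in at a. poly P \<epsilon> \<noteq> 0"
proof -
  have "finite {\<epsilon>. poly P \<epsilon> = 0}" using assms by (rule poly_roots_finite)
  then have "open (- ({\<epsilon>. poly P \<epsilon> = 0} - {a}))"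
    by (intro open_Compl finite_imp_closed finite_Diff)
  then show ?thesis
    unfolding eventually_at_topological by (intro exI[of _ "- ({\<epsilon>. poly P \<epsilon> = 0} - {a})"]) auto
qed

text \<open>
  A nonzero polynomial does not vanish identically on the curve through a generic point, because the
  curve reaches that point at \<open>\<epsilon> = 1\<close>; so only finitely many parameters are bad.
\<close>

lemma generic_shrink:
  assumes "\<forall>\<^sub>F t in generic. A t"
  shows "\<forall>\<^sub>F t in generic. \<forall>\<^sub>F \<epsilon> in at 0. A (shrink T \<epsilon> t)"
proof -
  obtain r where r: "r \<noteq> 0" "\<And>t. papp r t \<noteq> 0 \<Longrightarrow> A t"
    using assms by (auto simp: eventually_generic)
  show ?thesis
    using papp_generic_nonzero[OF r(1)]
  proof eventually_elim
    case (elim t)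
    obtain P :: "real poly" where P: "\<And>\<epsilon>. poly P \<epsilon> = papp r (shrink T \<epsilon> t)"
      using papp_shrink[of r] by meson
    have "shrink T 1 t = t" by (auto simp: shrink_def fun_eq_iff)
    then have "poly P 1 \<noteq> 0" using elim by (simp add: P)
    then have "P \<noteq> 0" by auto
    from eventually_poly_nonzero[OF this, of 0] show ?case
      by (rule eventually_mono) (auto simp: P intro: r(2))
  qed
qed

text \<open>
  In terms of valuations: let \<open>v\<close> be the order of vanishing in the indeterminates outside \<open>T\<close>. Then
  \<open>f\<close> specializes to \<open>c\<close> iff \<open>v (f - c) > 0\<close> and \<open>c\<close> is homogeneous of degree \<open>0\<close> in these
  indeterminates. The formulation with limits reduces the calculus of specialization to that of real
  limits.
\<close>

definition specializes :: "'v set \<Rightarrow> 'v polyfun fract \<Rightarrow> 'v polyfun fract \<Rightarrow> bool" where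
  "specializes T f c \<longleftrightarrow> (\<forall>\<^sub>F t in generic. ((\<lambda>\<epsilon>. fapp f (shrink T \<epsilon> t)) \<longlongrightarrow> fapp c t) (at 0))"

lemma specializes_add:
  assumes "specializes T f c" "specializes T g d"
  shows "specializes T (f + g) (c + d)"
  using generic_shrink[OF fapp_add[of f g], of T] fapp_add[of c d] assms unfolding specializes_def
  by eventually_elim (simp add: tendsto_add tendsto_cong)

lemma specializes_mult:
  assumes "specializes T f c" "specializes T g d"
  shows "specializes T (f * g) (c * d)"
  using generic_shrink[OF fapp_mult[of f g], of T] fapp_mult[of c d] assms unfolding specializes_def
  by eventually_elim (simp add: tendsto_mult tendsto_cong)

lemma specializes_uminus:
  assumes "specializes T f c"
  shows "specializes T (- f) (- c)"
  using generic_shrink[OF fapp_uminus[of f], of T] fapp_uminus[of c] assms unfolding specializes_def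
  by eventually_elim (simp add: tendsto_minus tendsto_cong)

lemma specializes_divide:
  assumes "specializes T f c" "specializes T g d" "g \<noteq> 0" "d \<noteq> 0"
  shows "specializes T (f / g) (c / d)"
  using generic_shrink[OF fapp_divide[OF assms(3), of f], of T] fapp_divide[OF assms(4), of c]
    fapp_nonzero[OF assms(4)] assms(1,2) unfolding specializes_def
  by eventually_elim (simp add: tendsto_divide tendsto_cong)

lemma specializes_0: "specializes T 0 0"
  using generic_shrink[OF fapp_0, of T] fapp_0 unfolding specializes_def
  by eventually_elim (simp add: tendsto_cong)

lemma specializes_1: "specializes T 1 1"
  using generic_shrink[OF fapp_1, of T] fapp_1 unfolding specializes_def
  by eventually_elim (simp add: tendsto_cong)

lemma specializes_power: "specializes T f c \<Longrightarrow> specializes T (f ^ n) (c ^ n)"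
  by (induction n) (simp_all add: specializes_1 specializes_mult)

lemma specializes_unique:
  assumes "specializes T f c" "specializes T f d"
  shows "c = d"
proof -
  have "\<forall>\<^sub>F t in generic. fapp c t = fapp d t"
    using assms unfolding specializes_def
    by eventually_elim (rule tendsto_unique[of "at (0 :: real)"], auto)
  then show ?thesis by (simp add: fapp_eq_iff)
qed

definition fvar :: "'v \<Rightarrow> 'v polyfun fract" where
  "fvar x = Fract (pvar x) 1"

lemma specializes_fvar: "specializes T (fvar x) (if x \<in> T then fvar x else 0)"
proof -
  have "\<forall>\<^sub>F t in generic. ((\<lambda>\<epsilon>. fapp (fvar x) (shrink T \<epsilon> t)) \<longlongrightarrow> (if x \<in> T then fapp (fvar x) t else 0)) (at 0)"
    using generic_shrink[OF fapp_poly[of "pvar x"], of T] fapp_poly[of "pvar x"]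
  proof eventually_elim
    case (elim t)
    have "((\<lambda>\<epsilon>. shrink T \<epsilon> t x) \<longlongrightarrow> (if x \<in> T then t x else 0)) (at 0)"
      by (cases "x \<in> T") (auto simp: shrink_def intro!: tendsto_eq_intros)
    then show ?case
      using elim unfolding fvar_def by (cases "x \<in> T") (simp_all add: tendsto_cong)
  qed
  then show ?thesis
    unfolding specializes_def using fapp_0 by eventually_elim (auto split: if_splits)
qed

text \<open>
  A quotient tending to \<open>0\<close> has positive order at \<open>0\<close>, so its \<open>n\<close>-th power has order at least \<open>n\<close>,
  which beats the order of \<open>p\<close>, a number bounded by its degree.
\<close>

lemma poly_quotient_power_tendsto_0:
  fixes a b p q :: "real poly"
  assumes "b \<noteq> 0" "p \<noteq> 0" "((\<lambda>\<epsilon>. poly a \<epsilon> / poly b \<epsilon>) \<longlongrightarrow> 0) (at 0)" "degree p < n"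
  shows "((\<lambda>\<epsilon>. (poly a \<epsilon> / poly b \<epsilon>) ^ n / (poly p \<epsilon> / poly q \<epsilon>)) \<longlongrightarrow> 0) (at 0)"
proof (cases "a = 0")
  case True
  then show ?thesis using assms(4) by (simp add: power_0_left)
next
  case False
  have split: "\<exists>i r. p = [:0, 1:] ^ i * r \<and> poly r 0 \<noteq> 0 \<and> i \<le> degree p" if p: "p \<noteq> 0" for p :: "real poly"
  proof -
    obtain r where r: "p = [:- 0, 1:] ^ Polynomial.order 0 p * r" "\<not> [:- 0, 1:] dvd r"
      using Polynomial.order_decomp[OF p, of 0] by metis
    moreover have "Polynomial.order 0 p \<le> degree p" using Polynomial.order_degree[OF p] .
    ultimately show ?thesis
      by (intro exI[of _ "Polynomial.order 0 p"] exI[of _ r]) (auto simp: dvd_iff_poly_eq_0)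
  qed
  obtain i r where i: "a = [:0, 1:] ^ i * r" "poly r 0 \<noteq> 0" using split[OF False] by blast
  obtain j s where j: "b = [:0, 1:] ^ j * s" "poly s 0 \<noteq> 0" using split[OF assms(1)] by blast
  obtain k u where k: "p = [:0, 1:] ^ k * u" "poly u 0 \<noteq> 0" "k \<le> degree p"
    using split[OF assms(2)] by blast
  have lim: "((\<lambda>\<epsilon>. poly f \<epsilon>) \<longlongrightarrow> poly f 0) (at 0)" for f :: "real poly"
    by (intro tendsto_intros)
  \<comment> \<open>Otherwise \<open>r = (a / b) * \<epsilon> ^ (j - i) * s\<close>, which does not vanish at \<open>0\<close>, would tend to \<open>0\<close>.\<close>
  have "j < i"
  proof (rule ccontr)
    assume "\<not> j < i"
    have "((\<lambda>\<epsilon>. (poly a \<epsilon> / poly b \<epsilon>) * (\<epsilon> ^ (j - i) * poly s \<epsilon>)) \<longlongrightarrow> 0 * (0 ^ (j - i) * poly s 0)) (at 0)"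
      by (intro tendsto_intros assms(3))
    moreover have "\<forall>\<^sub>F \<epsilon> in at 0. (poly a \<epsilon> / poly b \<epsilon>) * (\<epsilon> ^ (j - i) * poly s \<epsilon>) = poly r \<epsilon>"
    proof -
      have "s \<noteq> 0" using j by auto
      from eventually_poly_nonzero[OF this, of 0] eventually_neq_at_within[of 0 "0 :: real" UNIV]
      show ?thesis
      proof eventually_elim
        case (elim \<epsilon>)
        have "\<epsilon> ^ j = \<epsilon> ^ i * \<epsilon> ^ (j - i)" using \<open>\<not> j < i\<close> by (simp flip: power_add)
        then show ?case using elim by (simp add: i(1) j(1) poly_power)
      qed
    qed
    ultimately have "((\<lambda>\<epsilon>. poly r \<epsilon>) \<longlongrightarrow> 0) (at 0)"
      by (simp add: tendsto_cong)
    then show False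
      using LIM_unique[OF lim[of r]] i(2) by metis
  qed
  have "((\<lambda>\<epsilon>. \<epsilon> ^ ((i - j) * n - k) * (poly r \<epsilon> / poly s \<epsilon>) ^ n * poly q \<epsilon> / poly u \<epsilon>)
      \<longlongrightarrow> 0 ^ ((i - j) * n - k) * (poly r 0 / poly s 0) ^ n * poly q 0 / poly u 0) (at 0)"
    by (intro tendsto_intros j(2) k(2))
  moreover have pos: "k < (i - j) * n"
  proof -
    have "1 * n \<le> (i - j) * n" using \<open>j < i\<close> by (intro mult_le_mono1) simp
    then show ?thesis using k(3) assms(4) by linarith
  qed
  moreover have "\<forall>\<^sub>F \<epsilon> in at 0. (poly a \<epsilon> / poly b \<epsilon>) ^ n / (poly p \<epsilon> / poly q \<epsilon>)
      = \<epsilon> ^ ((i - j) * n - k) * (poly r \<epsilon> / poly s \<epsilon>) ^ n * poly q \<epsilon> / poly u \<epsilon>"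
    using eventually_neq_at_within[of 0 "0 :: real" UNIV]
  proof eventually_elim
    case (elim \<epsilon>)
    have "\<epsilon> ^ i = \<epsilon> ^ (i - j) * \<epsilon> ^ j" using \<open>j < i\<close> by (simp flip: power_add)
    then have "poly a \<epsilon> / poly b \<epsilon> = \<epsilon> ^ (i - j) * (poly r \<epsilon> / poly s \<epsilon>)"
      using elim by (simp add: i(1) j(1) poly_power)
    then have "(poly a \<epsilon> / poly b \<epsilon>) ^ n = \<epsilon> ^ ((i - j) * n) * (poly r \<epsilon> / poly s \<epsilon>) ^ n"
      by (simp only: power_mult_distrib power_mult)
    moreover have "\<epsilon> ^ ((i - j) * n) = \<epsilon> ^ ((i - j) * n - k) * \<epsilon> ^ k"
      using pos by (simp flip: power_add)
    ultimately show ?case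
      using elim by (simp add: k(1) poly_power)
  qed
  ultimately show ?thesis by (subst tendsto_cong) (auto simp: power_0_left split: if_splits)
qed

text \<open>
  The valuations behind specialization have rank one, hence some power of \<open>g\<close> beats \<open>f\<close>. The exponent
  can be chosen independently of \<open>T\<close> and \<open>g\<close>, because the numerator of \<open>f\<close> has bounded degree along
  all the curves involved.
\<close>

lemma specializes_0_power_divide:
  fixes f :: "'v polyfun fract"
  assumes "f \<noteq> 0"
  shows "\<exists>N. \<forall>n>N. \<forall>T g. specializes T g 0 \<longrightarrow> specializes T (g ^ n / f) 0"
proof -
  obtain p q where f: "f = Fract p q" "q \<noteq> 0" by (cases f) auto
  have p: "p \<noteq> 0" using assms f by (auto simp: Zero_fract_def eq_fract)
  obtain N where N: "\<forall>T t. \<exists>P :: real poly. degree P \<le> N \<and> (\<forall>\<epsilon>. poly P \<epsilon> = papp p (shrink T \<epsilon> t))"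
    using papp_shrink by blast
  show ?thesis
  proof (intro exI[of _ N] allI impI)
    fix n T and g :: "'v polyfun fract" assume "n > N" and g: "specializes T g 0"
    obtain a b where ab: "g = Fract a b" "b \<noteq> 0" by (cases g) auto
    have "\<forall>\<^sub>F t in generic. fapp (g ^ n / f) t = (papp a t / papp b t) ^ n / (papp p t / papp q t)"
      using fapp_divide[OF assms, of "g ^ n"] fapp_power[of g n] fapp_Fract[OF f(2), of p] fapp_Fract[OF ab(2), of a]
      unfolding f(1)[symmetric] ab(1)[symmetric] by eventually_elim simp
    then have 1: "\<forall>\<^sub>F t in generic. \<forall>\<^sub>F \<epsilon> in at 0. fapp (g ^ n / f) (shrink T \<epsilon> t) =
        (papp a (shrink T \<epsilon> t) / papp b (shrink T \<epsilon> t)) ^ n / (papp p (shrink T \<epsilon> t) / papp q (shrink T \<epsilon> t))"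
      by (rule generic_shrink)
    have 2: "\<forall>\<^sub>F t in generic. \<forall>\<^sub>F \<epsilon> in at 0. fapp g (shrink T \<epsilon> t) = papp a (shrink T \<epsilon> t) / papp b (shrink T \<epsilon> t)"
      unfolding ab(1) by (rule generic_shrink[OF fapp_Fract[OF ab(2)]])
    show "specializes T (g ^ n / f) 0"
      unfolding specializes_def
      using 1 2 g[unfolded specializes_def] fapp_0 papp_generic_nonzero[OF ab(2)] papp_generic_nonzero[OF p]
    proof eventually_elim
      case (elim t)
      obtain P :: "real poly" where P: "degree P \<le> N" "\<And>\<epsilon>. poly P \<epsilon> = papp p (shrink T \<epsilon> t)"
        using N by meson
      obtain Q :: "real poly" where Q: "\<And>\<epsilon>. poly Q \<epsilon> = papp q (shrink T \<epsilon> t)"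
        using papp_shrink by meson
      obtain A :: "real poly" where A: "\<And>\<epsilon>. poly A \<epsilon> = papp a (shrink T \<epsilon> t)"
        using papp_shrink by meson
      obtain B :: "real poly" where B: "\<And>\<epsilon>. poly B \<epsilon> = papp b (shrink T \<epsilon> t)"
        using papp_shrink by meson
      have "shrink T 1 t = t" by (auto simp: shrink_def fun_eq_iff)
      then have "poly P 1 \<noteq> 0" "poly B 1 \<noteq> 0" using elim by (simp_all add: P B)
      then have "P \<noteq> 0" "B \<noteq> 0" by auto
      moreover have "((\<lambda>\<epsilon>. poly A \<epsilon> / poly B \<epsilon>) \<longlongrightarrow> 0) (at 0)"
        using elim(2,3,4) by (simp add: A B tendsto_cong)
      ultimately have "((\<lambda>\<epsilon>. (poly A \<epsilon> / poly B \<epsilon>) ^ n / (poly P \<epsilon> / poly Q \<epsilon>)) \<longlongrightarrow> 0) (at 0)"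
        using P(1) \<open>n > N\<close> by (intro poly_quotient_power_tendsto_0) auto
      then show ?case
        using elim(1,4) by (simp add: A B P(2) Q tendsto_cong)
    qed
  qed
qed

section \<open>The ring of coherent families\<close>

definition monom_at :: "'v set \<Rightarrow> 'v polyfun fract" where
  "monom_at F = (\<Prod>x\<in>F. fvar x)"

lemma specializes_monom:
  assumes "finite F"
  shows "specializes T (monom_at F) (if F \<subseteq> T then monom_at F else 0)"
proof -
  have "specializes T (\<Prod>x\<in>F. fvar x) (\<Prod>x\<in>F. if x \<in> T then fvar x else 0)"
    using assms by induction (simp_all add: specializes_1 specializes_mult specializes_fvar)
  moreover have "(\<Prod>x\<in>F. if x \<in> T then fvar x else 0) = (if F \<subseteq> T then monom_at F else 0)"
  proof (cases "F \<subseteq> T")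
    case True
    then show ?thesis by (auto simp: monom_at_def intro!: prod.cong)
  next
    case False
    then show ?thesis using assms by (auto simp: prod_zero_iff)
  qed
  ultimately show ?thesis by (simp add: monom_at_def)
qed

text \<open>
  A convenient reason for sums of monomials to be nonzero: their value at the point with all
  coordinates \<open>1\<close> is positive.
\<close>

inductive_set positive_polys :: "'v polyfun fract set" where
  "papp p (\<lambda>_. 1) > 0 \<Longrightarrow> Fract p 1 \<in> positive_polys"

lemma positive_polys_nonzero: "f \<in> positive_polys \<Longrightarrow> f \<noteq> 0"
  by (induction rule: positive_polys.induct) (auto simp: Zero_fract_def eq_fract)

lemma positive_polys_add: "f \<in> positive_polys \<Longrightarrow> g \<in> positive_polys \<Longrightarrow> f + g \<in> positive_polys"
  by (auto elim!: positive_polys.cases intro!: positive_polys.intros)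

lemma monom_positive: "finite F \<Longrightarrow> monom_at F \<in> positive_polys"
proof (induction rule: finite_induct)
  case empty
  then show ?case by (auto simp: monom_at_def One_fract_def intro!: positive_polys.intros)
next
  case (insert x F)
  then show ?case
    by (auto simp: monom_at_def fvar_def elim!: positive_polys.cases intro!: positive_polys.intros)
qed

lemma sum_monom_nonzero:
  assumes "finite \<F>" "\<F> \<noteq> {}" "\<And>F. F \<in> \<F> \<Longrightarrow> finite F"
  shows "(\<Sum>F\<in>\<F>. monom_at F) \<noteq> 0"
proof -
  have "(\<Sum>F\<in>\<F>. monom_at F) \<in> positive_polys"
    using assms by (induction rule: finite_ne_induct) (simp_all add: monom_positive positive_polys_add)
  then show ?thesis by (rule positive_polys_nonzero)
qed

definition finitely_determined :: "'v set set \<Rightarrow> ('v set \<Rightarrow> 'c) \<Rightarrow> bool" where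
  "finitely_determined X f \<longleftrightarrow>
     (\<exists>S. finite S \<and> (\<forall>T\<in>X. \<forall>T'\<in>X. T \<inter> S = T' \<inter> S \<longrightarrow> f T = f T'))"

lemma finitely_determined_const: "(\<And>T. T \<in> X \<Longrightarrow> f T = c) \<Longrightarrow> finitely_determined X f"
  unfolding finitely_determined_def by (rule exI[of _ "{}"]) simp

lemma finitely_determined_comp:
  assumes "finitely_determined X f" "finitely_determined X g"
    and "\<And>T. T \<in> X \<Longrightarrow> k T = h (f T) (g T)"
  shows "finitely_determined X k"
proof -
  obtain S where S: "finite S" "\<forall>T\<in>X. \<forall>T'\<in>X. T \<inter> S = T' \<inter> S \<longrightarrow> f T = f T'"
    using assms(1) unfolding finitely_determined_def by (elim exE conjE)
  obtain S' where S': "finite S'" "\<forall>T\<in>X. \<forall>T'\<in>X. T \<inter> S' = T' \<inter> S' \<longrightarrow> g T = g T'"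
    using assms(2) unfolding finitely_determined_def by (elim exE conjE)
  have k: "k T = k T'" if T: "T \<in> X" "T' \<in> X" "T \<inter> (S \<union> S') = T' \<inter> (S \<union> S')" for T T'
  proof -
    have "T \<inter> S = T' \<inter> S" "T \<inter> S' = T' \<inter> S'" using T(3) by blast+
    then have "f T = f T'" "g T = g T'"
      using bspec[OF bspec[OF S(2) T(1)] T(2)] bspec[OF bspec[OF S'(2) T(1)] T(2)] by blast+
    then show ?thesis by (simp add: assms(3) T(1,2))
  qed
  show ?thesis
    unfolding finitely_determined_def
  proof (intro exI[of _ "S \<union> S'"] conjI ballI impI)
    show "finite (S \<union> S')" using S(1) S'(1) by simp
  qed (rule k)
qed

text \<open>
  A member of \<open>X\<close> has only finitely many possible traces on a finite set.
\<close>

lemma finitely_determined_finite_image: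
  assumes "finitely_determined X f"
  shows "finite (f ` X)"
proof -
  obtain S where S: "finite S" "\<And>T T'. T \<in> X \<Longrightarrow> T' \<in> X \<Longrightarrow> T \<inter> S = T' \<inter> S \<Longrightarrow> f T = f T'"
    using assms unfolding finitely_determined_def by metis
  define h where "h A = (SOME y. \<exists>T\<in>X. T \<inter> S = A \<and> y = f T)" for A
  have "f T = h (T \<inter> S)" if "T \<in> X" for T
  proof -
    have "y = f T" if "\<exists>T'\<in>X. T' \<inter> S = T \<inter> S \<and> y = f T'" for y
      using that S(2) \<open>T \<in> X\<close> by metis
    then show ?thesis
      unfolding h_def using \<open>T \<in> X\<close> by (intro some_equality[symmetric]) blast+
  qed
  then have "f ` X \<subseteq> h ` Pow S" by auto
  then show ?thesis using S(1) by (meson finite_Pow_iff finite_imageI finite_subset)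
qed

text \<open>
  For \<open>T = T'\<close> the last condition says that \<open>f T\<close> does not change when the indeterminates outside \<open>T\<close>
  are scaled. Such functions form a field, so a nonzero \<open>f T\<close> can be inverted there.
\<close>

definition coherent_family :: "'v set set \<Rightarrow> ('v set \<Rightarrow> 'v polyfun fract) \<Rightarrow> bool" where
  "coherent_family X f \<longleftrightarrow> (\<forall>T. T \<notin> X \<longrightarrow> f T = 0) \<and> finitely_determined X f \<and>
     (\<forall>T\<in>X. \<forall>T'\<in>X. T \<subseteq> T' \<longrightarrow> specializes T (f T') (f T))"

definition family_ring :: "'v set set \<Rightarrow> ('v set \<Rightarrow> 'v polyfun fract) ring" where
  "family_ring X = \<lparr>carrier = Collect (coherent_family X), monoid.mult = (\<lambda>f g T. f T * g T),
     one = (\<lambda>T. if T \<in> X then 1 else 0), zero = (\<lambda>T. 0), add = (\<lambda>f g T. f T + g T)\<rparr>"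

lemma family_ring_simps [simp]:
  "f \<in> carrier (family_ring X) \<longleftrightarrow> coherent_family X f"
  "f \<otimes>\<^bsub>family_ring X\<^esub> g = (\<lambda>T. f T * g T)"
  "f \<oplus>\<^bsub>family_ring X\<^esub> g = (\<lambda>T. f T + g T)"
  "\<one>\<^bsub>family_ring X\<^esub> = (\<lambda>T. if T \<in> X then 1 else 0)"
  "\<zero>\<^bsub>family_ring X\<^esub> = (\<lambda>T. 0)"
  by (simp_all add: family_ring_def)

lemma coherent_add: "coherent_family X f \<Longrightarrow> coherent_family X g \<Longrightarrow> coherent_family X (\<lambda>T. f T + g T)"
  unfolding coherent_family_def
  using finitely_determined_comp[of X f g "\<lambda>T. f T + g T" "(+)"]
  by (auto intro: specializes_add)

lemma coherent_mult: "coherent_family X f \<Longrightarrow> coherent_family X g \<Longrightarrow> coherent_family X (\<lambda>T. f T * g T)"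
  unfolding coherent_family_def
  using finitely_determined_comp[of X f g "\<lambda>T. f T * g T" "(*)"]
  by (auto intro: specializes_mult)

lemma coherent_uminus: "coherent_family X f \<Longrightarrow> coherent_family X (\<lambda>T. - f T)"
  unfolding coherent_family_def
  using finitely_determined_comp[of X f f "\<lambda>T. - f T" "\<lambda>a b. - a"]
  by (auto intro: specializes_uminus)

lemma coherent_0: "coherent_family X (\<lambda>T. 0)"
  unfolding coherent_family_def using finitely_determined_const[of X "\<lambda>T. 0" 0] by (auto intro: specializes_0)

lemma coherent_1: "coherent_family X (\<lambda>T. if T \<in> X then 1 else 0)"
  unfolding coherent_family_def using finitely_determined_const[of X "\<lambda>T. if T \<in> X then 1 else 0" 1] by (auto intro: specializes_1)

lemma cring_family_ring: "cring (family_ring X)"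
proof (rule cringI)
  show "abelian_group (family_ring X)"
  proof (rule abelian_groupI)
    fix f assume "f \<in> carrier (family_ring X)"
    then show "\<exists>g\<in>carrier (family_ring X). g \<oplus>\<^bsub>family_ring X\<^esub> f = \<zero>\<^bsub>family_ring X\<^esub>"
      by (intro bexI[of _ "\<lambda>T. - f T"]) (auto simp: coherent_uminus)
  qed (auto simp: coherent_add coherent_0 algebra_simps)
  show "Group.comm_monoid (family_ring X)"
    by (rule comm_monoidI)
      (auto simp: coherent_mult coherent_1 fun_eq_iff algebra_simps, auto simp: coherent_family_def)
qed (auto simp: algebra_simps)

text \<open>
  The quotient \<open>h T = g T ^ n / f T\<close> has to specialize correctly from \<open>T'\<close> to \<open>T\<close>. Where \<open>f T \<noteq> 0\<close>
  this is continuity of division. Where \<open>f T = 0\<close> but \<open>f T' \<noteq> 0\<close>, also \<open>g T = 0\<close>, and a large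
  exponent makes \<open>h T'\<close> specialize to \<open>0\<close>. One exponent serves all pairs because \<open>f\<close> has only
  finitely many values.
\<close>

lemma coherent_divides_power:
  assumes f: "coherent_family X f" and g: "coherent_family X g"
    and zeros: "\<And>T. T \<in> X \<Longrightarrow> f T = 0 \<Longrightarrow> g T = 0"
  obtains n h where "n > 0" "coherent_family X h" "\<And>T. g T ^ n = h T * f T"
proof -
  have "\<forall>c\<in>f ` X - {0}. \<exists>N. \<forall>n>N. \<forall>T d. specializes T d 0 \<longrightarrow> specializes T (d ^ n / c) 0"
    using specializes_0_power_divide by blast
  then obtain N where N: "\<And>c n T d. c \<in> f ` X - {0} \<Longrightarrow> n > N c \<Longrightarrow> specializes T d 0 \<Longrightarrow> specializes T (d ^ n / c) 0"
    by metis
  have "finite (f ` X - {0})"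
    using f finitely_determined_finite_image unfolding coherent_family_def by blast
  \<comment> \<open>A common exponent above the bounds for all nonzero values of \<open>f\<close>.\<close>
  define n where "n = Suc (\<Sum>c\<in>f ` X - {0}. N c)"
  have n: "n > N c" if "c \<in> f ` X - {0}" for c
    using member_le_sum[OF that, of N] \<open>finite (f ` X - {0})\<close> unfolding n_def by simp
  define h where "h T = g T ^ n / f T" for T
  show ?thesis
  proof (rule that)
    show "n > 0" by (simp add: n_def)
    show "g T ^ n = h T * f T" for T
      using zeros[of T] f g \<open>n > 0\<close> unfolding h_def coherent_family_def by (cases "T \<in> X") (auto simp: power_0_left)
    show "coherent_family X h"
      unfolding coherent_family_def
    proof (intro conjI ballI allI impI)
      show "h T = 0" if "T \<notin> X" for T
        using that f unfolding h_def coherent_family_def by simp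
      show "finitely_determined X h"
        using f g finitely_determined_comp[of X g f h "\<lambda>a b. a ^ n / b"]
        by (simp add: h_def coherent_family_def)
      fix T T' assume T: "T \<in> X" "T' \<in> X" "T \<subseteq> T'"
      then have sf: "specializes T (f T') (f T)" and sg: "specializes T (g T') (g T)"
        using f g unfolding coherent_family_def by auto
      show "specializes T (h T') (h T)"
      proof (cases "f T' = 0")
        case True
        then have "f T = 0" using sf specializes_unique specializes_0 by metis
        then show ?thesis using True by (simp add: h_def specializes_0)
      next
        case f': False
        show ?thesis
        proof (cases "f T = 0")
          case True
          then have "specializes T (g T') 0" using sg zeros T(1) by metis
          then show ?thesis
            using N[OF _ n] f' T True unfolding h_def by auto
        next
          case False
          then show ?thesis
            unfolding h_def using f' sf sg by (intro specializes_divide specializes_power)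
        qed
      qed
    qed
  qed
qed

text \<open>
  The monomial \<open>\<Prod>x\<in>F. t\<^sub>x\<close> as an element of the ring; its support is the basic open set of \<open>F\<close>.
\<close>

definition family_monom :: "'v set set \<Rightarrow> 'v set \<Rightarrow> 'v set \<Rightarrow> 'v polyfun fract" where
  "family_monom X F T = (if T \<in> X \<and> F \<subseteq> T then monom_at F else 0)"

lemma family_monom_eq_0_iff: "finite F \<Longrightarrow> T \<in> X \<Longrightarrow> family_monom X F T = 0 \<longleftrightarrow> \<not> F \<subseteq> T"
  using monom_positive positive_polys_nonzero by (auto simp: family_monom_def)

lemma coherent_monom:
  assumes "finite F"
  shows "coherent_family X (family_monom X F)"
  unfolding coherent_family_def
proof (intro conjI ballI allI impI)
  show "finitely_determined X (family_monom X F)"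
    unfolding finitely_determined_def family_monom_def
    using assms by (intro exI[of _ F]) auto
  fix T T' assume "T \<in> X" "T' \<in> X" "T \<subseteq> T'"
  then show "specializes T (family_monom X F T') (family_monom X F T)"
    using specializes_monom[OF assms, of T] specializes_0[of T]
    by (auto simp: family_monom_def split: if_splits)
qed (simp add: family_monom_def)

section \<open>Its prime ideals, over an algebraic closure system\<close>

locale algebraic_closure_system =
  fixes V :: "'v set" and X :: "'v set set"
  assumes subset: "\<And>T. T \<in> X \<Longrightarrow> T \<subseteq> V"
    and top: "V \<in> X"
    and Inter: "\<And>\<Y>. \<Y> \<noteq> {} \<Longrightarrow> \<Y> \<subseteq> X \<Longrightarrow> \<Inter>\<Y> \<in> X"
    and finitary: "\<And>T. T \<subseteq> V \<Longrightarrow> (\<And>F. finite F \<Longrightarrow> F \<subseteq> T \<Longrightarrow> \<Inter>{Y \<in> X. F \<subseteq> Y} \<subseteq> T) \<Longrightarrow> T \<in> X"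
begin

definition cl :: "'v set \<Rightarrow> 'v set" where
  "cl F = \<Inter>{Y \<in> X. F \<subseteq> Y}"

lemma cl_in: "F \<subseteq> V \<Longrightarrow> cl F \<in> X"
  unfolding cl_def using top by (intro Inter) auto

lemma cl_increasing: "F \<subseteq> cl F"
  unfolding cl_def by blast

lemma cl_least: "T \<in> X \<Longrightarrow> F \<subseteq> T \<Longrightarrow> cl F \<subseteq> T"
  unfolding cl_def by blast

text \<open>
  If \<open>S\<close> determines \<open>f\<close> and \<open>f T' \<noteq> 0\<close>, then \<open>f\<close> has the same value at the closure \<open>T0\<close> of
  \<open>T' \<inter> S\<close>, and any \<open>T\<close> above \<open>T0\<close> inherits a nonzero value because \<open>f T\<close> specializes to \<open>f T0\<close>.
  So the traces on \<open>S\<close> of the support generate the support.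
\<close>

lemma support_is_finite_union:
  assumes f: "coherent_family X f"
  obtains \<F> where "finite \<F>" "\<And>F. F \<in> \<F> \<Longrightarrow> finite F" "\<And>F. F \<in> \<F> \<Longrightarrow> F \<subseteq> V"
    "\<And>T. T \<in> X \<Longrightarrow> f T \<noteq> 0 \<longleftrightarrow> (\<exists>F\<in>\<F>. F \<subseteq> T)"
proof -
  obtain S where S: "finite S" "\<And>T T'. T \<in> X \<Longrightarrow> T' \<in> X \<Longrightarrow> T \<inter> S = T' \<inter> S \<Longrightarrow> f T = f T'"
    using f unfolding coherent_family_def finitely_determined_def by metis
  define \<F> where "\<F> = {T \<inter> S | T. T \<in> X \<and> f T \<noteq> 0}"
  have sub: "\<F> \<subseteq> Pow S" by (auto simp: \<F>_def)
  show ?thesis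
  proof (rule that)
    show "finite \<F>" using sub S(1) finite_subset by blast
    show "finite F" if "F \<in> \<F>" for F using that sub S(1) finite_subset by blast
    show "F \<subseteq> V" if "F \<in> \<F>" for F using that subset by (auto simp: \<F>_def)
    fix T assume T: "T \<in> X"
    show "f T \<noteq> 0 \<longleftrightarrow> (\<exists>F\<in>\<F>. F \<subseteq> T)"
    proof
      assume "f T \<noteq> 0"
      then show "\<exists>F\<in>\<F>. F \<subseteq> T" using T by (auto simp: \<F>_def)
    next
      assume "\<exists>F\<in>\<F>. F \<subseteq> T"
      then obtain T' where T': "T' \<in> X" "f T' \<noteq> 0" "T' \<inter> S \<subseteq> T" by (auto simp: \<F>_def)
      define T0 where "T0 = cl (T' \<inter> S)"
      have T0: "T0 \<in> X" unfolding T0_def using subset[OF T'(1)] by (intro cl_in) auto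
      have "T0 \<subseteq> T'" "T0 \<subseteq> T" "T' \<inter> S \<subseteq> T0"
        unfolding T0_def using cl_least[OF T'(1)] cl_least[OF T T'(3)] cl_increasing by auto
      then have "T0 \<inter> S = T' \<inter> S" by blast
      then have "f T0 \<noteq> 0" using S(2)[OF T0 T'(1)] T'(2) by simp
      moreover have "specializes T0 (f T) (f T0)"
        using f T0 T \<open>T0 \<subseteq> T\<close> unfolding coherent_family_def by blast
      ultimately show "f T \<noteq> 0"
        using specializes_unique specializes_0 by metis
    qed
  qed
qed

lemma vanishing_power_in_prime:
  assumes Q: "primeideal Q (family_ring X)"
    and f: "coherent_family X f" and g: "coherent_family X g"
    and zeros: "\<And>T. T \<in> X \<Longrightarrow> f T = 0 \<Longrightarrow> g T = 0" and "f \<in> Q"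
  shows "g \<in> Q"
proof -
  interpret primeideal Q "family_ring X" by (rule Q)
  obtain n h where n: "n > 0" "coherent_family X h" "\<And>T. g T ^ n = h T * f T"
    using coherent_divides_power[OF f g zeros] by blast
  have "(\<lambda>T. g T ^ n) = h \<otimes>\<^bsub>family_ring X\<^esub> f"
    by (simp add: n(3))
  then have "(\<lambda>T. g T ^ n) \<in> Q"
    using I_l_closed[OF \<open>f \<in> Q\<close>, of h] n(2) by simp
  moreover have "(\<lambda>T. g T ^ m) \<in> Q \<Longrightarrow> m > 0 \<Longrightarrow> g \<in> Q \<and> coherent_family X (\<lambda>T. g T ^ m)" for m
  proof (induction m)
    case (Suc m)
    show ?case
    proof (cases "m = 0")
      case False
      have coh: "coherent_family X (\<lambda>T. g T ^ k)" if "k > 0" for k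
        using that
      proof (induction k)
        case (Suc k)
        then show ?case using g coherent_mult[OF g, of "\<lambda>T. g T ^ k"] by (cases "k = 0") auto
      qed simp
      have "g \<in> Q \<or> (\<lambda>T. g T ^ m) \<in> Q"
        using I_prime[of g "\<lambda>T. g T ^ m"] Suc.prems g coh[of m] False by simp
      then show ?thesis using Suc False coh[of "Suc m"] by auto
    qed (use Suc g in simp)
  qed simp
  ultimately show ?thesis using n(1) by blast
qed

lemma monom_notin_prime_iff:
  assumes Q: "primeideal Q (family_ring X)" and "finite F"
  shows "family_monom X F \<notin> Q \<longleftrightarrow> (\<forall>x\<in>F. family_monom X {x} \<notin> Q)"
  using \<open>finite F\<close>
proof (induction rule: finite_induct)
  interpret primeideal Q "family_ring X" by (rule Q)
  case empty
  have "family_monom X {} = \<one>\<^bsub>family_ring X\<^esub>"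
    by (auto simp: family_monom_def monom_at_def)
  then show ?case using I_notcarr one_imp_carrier by auto
next
  interpret primeideal Q "family_ring X" by (rule Q)
  case (insert x F)
  have eq: "family_monom X (insert x F) = family_monom X {x} \<otimes>\<^bsub>family_ring X\<^esub> family_monom X F"
    using insert by (auto simp: family_monom_def monom_at_def fun_eq_iff)
  have c: "family_monom X {x} \<in> carrier (family_ring X)" "family_monom X F \<in> carrier (family_ring X)"
    using insert by (auto intro!: coherent_monom)
  have "family_monom X (insert x F) \<in> Q \<longleftrightarrow> family_monom X {x} \<in> Q \<or> family_monom X F \<in> Q"
    unfolding eq using I_prime[OF c] I_l_closed[OF _ c(1)] I_r_closed[OF _ c(2)] by blast
  then show ?case using insert by auto
qed

text \<open>
  The point is \<open>T = {x. t\<^sub>x \<notin> Q}\<close>. It belongs to \<open>X\<close> since, for \<open>y\<close> in the closure of a finite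
  \<open>F \<subseteq> T\<close>, the monomial of \<open>F\<close> vanishes wherever \<open>t\<^sub>y\<close> does. To compare \<open>f \<in> Q\<close> with \<open>f T = 0\<close>,
  write the support of \<open>f\<close> as a finite union of basic open sets: then \<open>f\<close> has the support of a sum
  of monomials and may be replaced by that sum.
\<close>

lemma prime_is_kernel:
  assumes Q: "primeideal Q (family_ring X)"
  obtains T where "T \<in> X" "\<And>f. coherent_family X f \<Longrightarrow> f \<in> Q \<longleftrightarrow> f T = 0"
proof -
  interpret primeideal Q "family_ring X" by (rule Q)
  define T where "T = {x \<in> V. family_monom X {x} \<notin> Q}"
  have monom: "family_monom X F \<notin> Q \<longleftrightarrow> F \<subseteq> T" if "finite F" "F \<subseteq> V" for F
    using that monom_notin_prime_iff[OF Q] unfolding T_def by blast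
  have "T \<in> X"
  proof (rule finitary)
    show "T \<subseteq> V" by (auto simp: T_def)
    fix F assume F: "finite F" "F \<subseteq> T"
    show "\<Inter>{Y \<in> X. F \<subseteq> Y} \<subseteq> T"
    proof
      fix y assume y: "y \<in> \<Inter>{Y \<in> X. F \<subseteq> Y}"
      have "y \<in> V" using y top F by (auto simp: T_def)
      moreover have "family_monom X {y} \<notin> Q"
      proof
        assume "family_monom X {y} \<in> Q"
        then have "family_monom X F \<in> Q"
        proof (rule vanishing_power_in_prime[OF Q, rotated 3])
          fix Y assume "Y \<in> X" "family_monom X {y} Y = 0"
          then show "family_monom X F Y = 0"
            using y F(1) by (auto simp: family_monom_eq_0_iff)
        qed (auto simp: coherent_monom F(1))
        then show False using monom[OF F(1)] F by (auto simp: T_def)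
      qed
      ultimately show "y \<in> T" by (simp add: T_def)
    qed
  qed
  moreover have "f \<in> Q \<longleftrightarrow> f T = 0" if f: "coherent_family X f" for f
  proof -
    obtain \<F> where \<F>: "finite \<F>" "\<And>F. F \<in> \<F> \<Longrightarrow> finite F" "\<And>F. F \<in> \<F> \<Longrightarrow> F \<subseteq> V"
      "\<And>T. T \<in> X \<Longrightarrow> f T \<noteq> 0 \<longleftrightarrow> (\<exists>F\<in>\<F>. F \<subseteq> T)"
      using support_is_finite_union[OF f] by metis
    show ?thesis
    proof
      assume "f \<in> Q"
      show "f T = 0"
      proof (rule ccontr)
        assume "f T \<noteq> 0"
        then obtain F where F: "F \<in> \<F>" "F \<subseteq> T" using \<F>(4)[OF \<open>T \<in> X\<close>] by blast
        have "family_monom X F \<in> Q"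
        proof (rule vanishing_power_in_prime[OF Q f _ _ \<open>f \<in> Q\<close>])
          fix Y assume "Y \<in> X" "f Y = 0"
          then show "family_monom X F Y = 0"
            using F(1) \<F>(2)[OF F(1)] \<F>(4)[of Y] by (auto simp: family_monom_eq_0_iff)
        qed (rule coherent_monom[OF \<F>(2)[OF F(1)]])
        then show False using monom[of F] F \<F>(2,3) by blast
      qed
    next
      assume "f T = 0"
      then have in_Q: "family_monom X F \<in> Q" if "F \<in> \<F>" for F
        using monom[of F] \<F> \<open>T \<in> X\<close> that by blast
      \<comment> \<open>The sum of the monomials of \<open>\<F>\<close> lies in \<open>Q\<close> and has the same support as \<open>f\<close>.\<close>
      define e where "e \<G> Y = (\<Sum>F\<in>\<G>. family_monom X F Y)" for \<G> Y
      have "e \<G> \<in> Q \<and> coherent_family X (e \<G>)" if "finite \<G>" "\<G> \<subseteq> \<F>" for \<G>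
        using that
      proof (induction rule: finite_induct)
        case empty
        have "e {} = \<zero>\<^bsub>family_ring X\<^esub>" by (simp add: e_def fun_eq_iff)
        then show ?case using additive_subgroup.zero_closed[OF additive_subgroup_axioms] coherent_0 by (simp add: e_def)
      next
        case (insert F \<G>)
        have "e (insert F \<G>) = family_monom X F \<oplus>\<^bsub>family_ring X\<^esub> e \<G>"
          using insert by (simp add: e_def fun_eq_iff)
        then show ?case
          using insert in_Q[of F] additive_subgroup.a_closed[OF additive_subgroup_axioms, of "family_monom X F" "e \<G>"] \<F>(2)[of F]
          by (simp add: coherent_add coherent_monom)
      qed
      then have e: "e \<F> \<in> Q" "coherent_family X (e \<F>)" using \<F>(1) by auto
      show "f \<in> Q"
      proof (rule vanishing_power_in_prime[OF Q e(2) f _ e(1)])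
        fix Y assume Y: "Y \<in> X" "e \<F> Y = 0"
        have "e \<F> Y = (\<Sum>F | F \<in> \<F> \<and> F \<subseteq> Y. monom_at F)"
          unfolding e_def family_monom_def using Y(1) \<F>(1) by (simp add: sum.If_cases Int_def)
        then have "{F \<in> \<F>. F \<subseteq> Y} = {}"
          using sum_monom_nonzero[of "{F \<in> \<F>. F \<subseteq> Y}"] \<F>(1,2) Y(2) by auto
        then show "f Y = 0" using \<F>(4)[OF Y(1)] by blast
      qed
    qed
  qed
  ultimately show ?thesis by (rule that)
qed

lemma kernel_is_prime:
  assumes "T \<in> X"
  shows "primeideal {f. coherent_family X f \<and> f T = 0} (family_ring X)"
    (is "primeideal ?P ?R")
proof -
  interpret cring ?R by (rule cring_family_ring)
  have mem: "f \<in> ?P \<longleftrightarrow> coherent_family X f \<and> f T = 0" for f by simp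
  have minus: "\<ominus>\<^bsub>?R\<^esub> f = (\<lambda>T. - f T)" if "coherent_family X f" for f
    by (rule minus_equality) (use that in \<open>simp_all add: coherent_uminus\<close>)
  have sub: "subgroup ?P (add_monoid ?R)"
  proof (rule add.subgroupI)
    show "?P \<subseteq> carrier ?R" by auto
    show "?P \<noteq> {}" using coherent_0 by blast
    show "\<ominus>\<^bsub>?R\<^esub> f \<in> ?P" if "f \<in> ?P" for f
      using that by (simp add: minus coherent_uminus)
    show "f \<oplus>\<^bsub>?R\<^esub> g \<in> ?P" if "f \<in> ?P" "g \<in> ?P" for f g
      using that by (simp add: coherent_add)
  qed
  have ideal: "ideal ?P ?R"
  proof (rule idealI[OF ring_axioms sub])
    show "x \<otimes>\<^bsub>?R\<^esub> f \<in> ?P" "f \<otimes>\<^bsub>?R\<^esub> x \<in> ?P" if "f \<in> ?P" "x \<in> carrier ?R" for f x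
      using that by (simp_all add: coherent_mult)
  qed
  show ?thesis
  proof (rule primeidealI[OF ideal cring_family_ring])
    have "\<one>\<^bsub>?R\<^esub> \<in> carrier ?R" "\<one>\<^bsub>?R\<^esub> \<notin> ?P"
      using assms by (simp_all add: coherent_1)
    then show "carrier ?R \<noteq> ?P" by blast
    show "f \<in> ?P \<or> g \<in> ?P" if "f \<in> carrier ?R" "g \<in> carrier ?R" "f \<otimes>\<^bsub>?R\<^esub> g \<in> ?P" for f g
      using that by simp
  qed
qed

end

section \<open>Codes for rational functions\<close>

text \<open>
  A pairing that stays within one type, so that codes of subexpressions can be combined.
\<close>

definition pair_code :: "(nat \<times> 'x) set \<Rightarrow> (nat \<times> 'x) set \<Rightarrow> (nat \<times> 'x) set" where
  "pair_code A B = (\<lambda>(n, x). (2 * n, x)) ` A \<union> (\<lambda>(n, x). (2 * n + 1, x)) ` B"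

lemma pair_code_inject [simp]: "pair_code A B = pair_code A' B' \<longleftrightarrow> A = A' \<and> B = B'"
proof -
  have mem: "(2 * n, x) \<in> pair_code A B \<longleftrightarrow> (n, x) \<in> A" "(2 * n + 1, x) \<in> pair_code A B \<longleftrightarrow> (n, x) \<in> B"
    for A B :: "(nat \<times> 'a) set" and n x
  proof -
    show "(2 * n, x) \<in> pair_code A B \<longleftrightarrow> (n, x) \<in> A"
      by (auto simp: pair_code_def image_iff Bex_def double_not_eq_Suc_double)
    show "(2 * n + 1, x) \<in> pair_code A B \<longleftrightarrow> (n, x) \<in> B"
      by (auto simp: pair_code_def image_iff Bex_def Suc_double_not_eq_double)
  qed
  show ?thesis
  proof
    assume eq: "pair_code A B = pair_code A' B'"
    have "(n, x) \<in> A \<longleftrightarrow> (n, x) \<in> A'" "(n, x) \<in> B \<longleftrightarrow> (n, x) \<in> B'" for n x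
      using mem[of n x A B] mem[of n x A' B'] unfolding eq by simp_all
    then show "A = A' \<and> B = B'" by auto
  qed simp
qed

primrec expr_code :: "'v pexpr \<Rightarrow> (nat \<times> 'v set) set" where
  "expr_code Minus_One = pair_code {(0, {})} {}"
| "expr_code (Var x) = pair_code {(1, {})} {(0, {x})}"
| "expr_code (Plus a b) = pair_code {(2, {})} (pair_code (expr_code a) (expr_code b))"
| "expr_code (Times a b) = pair_code {(3, {})} (pair_code (expr_code a) (expr_code b))"

lemma inj_expr_code: "inj expr_code"
proof
  fix a b :: "'v pexpr" assume "expr_code a = expr_code b"
  then show "a = b"
    by (induction a arbitrary: b) (case_tac b; simp)+
qed

lemma fract_code:
  obtains code :: "'v polyfun fract \<Rightarrow> (nat \<times> 'v set) set" where "inj code"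
proof -
  have "\<forall>f :: 'v polyfun fract. \<exists>e. f = Fract (Abs_polyfun (peval (fst e))) (Abs_polyfun (peval (snd e)))"
  proof
    fix f :: "'v polyfun fract"
    obtain p q where f: "f = Fract p q" by (cases f)
    obtain a b where "papp p = peval a" "papp q = peval b" using papp by blast
    then show "\<exists>e. f = Fract (Abs_polyfun (peval (fst e))) (Abs_polyfun (peval (snd e)))"
      by (intro exI[of _ "(a, b)"]) (metis f fst_conv papp_inverse snd_conv)
  qed
  then obtain e where e: "\<And>f :: 'v polyfun fract. f = Fract (Abs_polyfun (peval (fst (e f)))) (Abs_polyfun (peval (snd (e f))))"
    by metis
  have "inj (\<lambda>f. pair_code (expr_code (fst (e f))) (expr_code (snd (e f))))"
  proof
    fix f g assume "pair_code (expr_code (fst (e f))) (expr_code (snd (e f))) =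
      pair_code (expr_code (fst (e g))) (expr_code (snd (e g)))"
    then have "fst (e f) = fst (e g)" "snd (e f) = snd (e g)"
      using inj_expr_code by (auto dest: injD)
    then show "f = g" using e[of f] e[of g] by simp
  qed
  then show ?thesis by (rule that)
qed

section \<open>Algebraic closure systems are spectral spaces\<close>

lemma prime_spectrum_subset: "P \<in> prime_spectrum R \<Longrightarrow> P \<subseteq> carrier R"
  unfolding prime_spectrum_def mem_Collect_eq
  using additive_subgroup.a_subset ideal.axioms(1) primeideal.axioms(1) by blast

lemma topspace_zariski_spec: "topspace (zariski_spec R) = prime_spectrum R"
proof
  show "topspace (zariski_spec R) \<subseteq> prime_spectrum R"
    unfolding topspace_def openin_zariski_spec by blast
  have "prime_spectrum R = prime_spectrum R - {P \<in> prime_spectrum R. carrier R \<subseteq> P}"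
  proof -
    have "\<not> carrier R \<subseteq> P" if "primeideal P R" for P
    proof -
      interpret primeideal P R by (rule that)
      show ?thesis using I_notcarr a_subset by blast
    qed
    then show ?thesis by (auto simp: prime_spectrum_def)
  qed
  then have "openin (zariski_spec R) (prime_spectrum R)"
    unfolding openin_zariski_spec by blast
  then show "prime_spectrum R \<subseteq> topspace (zariski_spec R)"
    by (rule openin_subset)
qed

text \<open>
  The contravariant functoriality of the spectrum.
\<close>

lemma continuous_map_spec_vimage:
  assumes R: "cring R" and S: "cring S" and h: "h \<in> ring_hom R S"
  shows "continuous_map (zariski_spec S) (zariski_spec R) (\<lambda>Q. {r \<in> carrier R. h r \<in> Q})"
proof -
  interpret R: cring R by (rule R)
  interpret S: cring S by (rule S)
  interpret h: ring_hom_ring R S h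
    by (rule ring_hom_ringI2[OF R.ring_axioms S.ring_axioms h])
  have prime: "{r \<in> carrier R. h r \<in> Q} \<in> prime_spectrum R" if "Q \<in> prime_spectrum S" for Q
    using h.primeideal_vimage[OF R] that by (simp add: prime_spectrum_def)
  show ?thesis
    unfolding continuous_map_def topspace_zariski_spec
  proof (intro conjI allI impI)
    fix U assume "openin (zariski_spec R) U"
    then obtain A where A: "A \<subseteq> carrier R" "U = prime_spectrum R - {P \<in> prime_spectrum R. A \<subseteq> P}"
      by (auto simp: openin_zariski_spec)
    have "h ` A \<subseteq> carrier S" using A(1) h.hom_closed by blast
    moreover have "{Q \<in> prime_spectrum S. {r \<in> carrier R. h r \<in> Q} \<in> U} =
        prime_spectrum S - {P \<in> prime_spectrum S. h ` A \<subseteq> P}"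
      using A prime by blast
    ultimately show "openin (zariski_spec S) {Q \<in> prime_spectrum S. {r \<in> carrier R. h r \<in> Q} \<in> U}"
      unfolding openin_zariski_spec by blast
  qed (use prime in auto)
qed

lemma ring_iso_imp_homeomorphic_spec:
  assumes R: "cring R" and S: "cring S" and h: "h \<in> ring_iso R S"
  shows "zariski_spec R homeomorphic_space zariski_spec S"
proof -
  interpret R: cring R by (rule R)
  interpret S: cring S by (rule S)
  define k where "k = inv_into (carrier R) h"
  have bij: "bij_betw h (carrier R) (carrier S)" and hom: "h \<in> ring_hom R S"
    using h by (auto simp: ring_iso_def)
  have k: "k \<in> ring_hom S R"
    using ring_iso_set_sym[OF R.ring_axioms h] by (simp add: k_def ring_iso_def)
  have kh: "k (h r) = r" if "r \<in> carrier R" for r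
    unfolding k_def using bij that by (simp add: bij_betw_inv_into_left)
  have hk: "h (k s) = s" if "s \<in> carrier S" for s
    unfolding k_def using bij that by (simp add: bij_betw_inv_into_right)
  have "homeomorphic_maps (zariski_spec R) (zariski_spec S)
      (\<lambda>P. {s \<in> carrier S. k s \<in> P}) (\<lambda>Q. {r \<in> carrier R. h r \<in> Q})"
    unfolding homeomorphic_maps_def topspace_zariski_spec
  proof (intro conjI ballI)
    show "{r \<in> carrier R. h r \<in> {s \<in> carrier S. k s \<in> P}} = P" if "P \<in> prime_spectrum R" for P
      using prime_spectrum_subset[OF that] ring_hom_closed[OF hom] by (auto simp: kh)
    show "{s \<in> carrier S. k s \<in> {r \<in> carrier R. h r \<in> Q}} = Q" if "Q \<in> prime_spectrum S" for Q
      using prime_spectrum_subset[OF that] ring_hom_closed[OF k] by (auto simp: hk)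
  qed (intro continuous_map_spec_vimage R S hom k)+
  then show ?thesis unfolding homeomorphic_space_def by blast
qed

context algebraic_closure_system
begin

lemma homeomorphic_spec_family_ring:
  assumes Y: "openin Y = arbitrary union_of (\<lambda>U. \<exists>F. finite F \<and> F \<subseteq> V \<and> U = {T \<in> X. F \<subseteq> T})"
  shows "Y homeomorphic_space zariski_spec (family_ring X)"
proof -
  define \<phi> where "\<phi> T = {f. coherent_family X f \<and> f T = 0}" for T :: "'v set"
  have basic: "openin Y {T \<in> X. F \<subseteq> T}" if "finite F" "F \<subseteq> V" for F
    unfolding Y using that by (intro arbitrary_union_of_inc) blast
  have topspace: "topspace Y = X"
  proof
    show "topspace Y \<subseteq> X" unfolding topspace_def Y union_of_def by blast
    show "X \<subseteq> topspace Y" using openin_subset[OF basic[of "{}"]] by simp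
  qed
  have prime: "\<phi> T \<in> prime_spectrum (family_ring X)" if "T \<in> X" for T
    using kernel_is_prime[OF that] by (simp add: \<phi>_def prime_spectrum_def)
  have "homeomorphic_map Y (zariski_spec (family_ring X)) \<phi>"
  proof (rule bijective_open_imp_homeomorphic_map)
    show "continuous_map Y (zariski_spec (family_ring X)) \<phi>"
      unfolding continuous_map_def topspace topspace_zariski_spec
    proof (intro conjI allI impI)
      show "\<phi> \<in> X \<rightarrow> prime_spectrum (family_ring X)" using prime by blast
      fix U assume "openin (zariski_spec (family_ring X)) U"
      then obtain A where A: "A \<subseteq> carrier (family_ring X)"
        "U = prime_spectrum (family_ring X) - {P \<in> prime_spectrum (family_ring X). A \<subseteq> P}"
        by (auto simp: openin_zariski_spec)
      have "{T \<in> X. \<phi> T \<in> U} = (\<Union>f\<in>A. {T \<in> X. f T \<noteq> 0})"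
        using A prime unfolding \<phi>_def by auto
      moreover have "openin Y {T \<in> X. f T \<noteq> 0}" if "f \<in> A" for f
      proof -
        have f: "coherent_family X f" using that A(1) by auto
        obtain \<F> where \<F>: "finite \<F>" "\<And>F. F \<in> \<F> \<Longrightarrow> finite F" "\<And>F. F \<in> \<F> \<Longrightarrow> F \<subseteq> V"
          "\<And>T. T \<in> X \<Longrightarrow> f T \<noteq> 0 \<longleftrightarrow> (\<exists>F\<in>\<F>. F \<subseteq> T)"
          using support_is_finite_union[OF f] by metis
        have "{T \<in> X. f T \<noteq> 0} = (\<Union>F\<in>\<F>. {T \<in> X. F \<subseteq> T})"
          using \<F>(4) by auto
        then show ?thesis using basic \<F>(2,3) by auto
      qed
      ultimately show "openin Y {T \<in> X. \<phi> T \<in> U}" by auto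
    qed
    show image: "\<phi> ` topspace Y = topspace (zariski_spec (family_ring X))"
      unfolding topspace topspace_zariski_spec
    proof
      show "\<phi> ` X \<subseteq> prime_spectrum (family_ring X)" using prime by blast
      show "prime_spectrum (family_ring X) \<subseteq> \<phi> ` X"
      proof
        fix Q assume "Q \<in> prime_spectrum (family_ring X)"
        then have Q: "primeideal Q (family_ring X)" by (simp add: prime_spectrum_def)
        interpret primeideal Q "family_ring X" by (rule Q)
        obtain T where T: "T \<in> X" "\<And>f. coherent_family X f \<Longrightarrow> f \<in> Q \<longleftrightarrow> f T = 0"
          using prime_is_kernel[OF Q] by metis
        have "Q = \<phi> T"
          using T(2) a_subset unfolding \<phi>_def by auto
        then show "Q \<in> \<phi> ` X" using T(1) by blast
      qed
    qed
    have mem_iff: "F \<subseteq> T \<longleftrightarrow> family_monom X F \<notin> \<phi> T" if "T \<in> X" "finite F" for F T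
      using that by (simp add: \<phi>_def coherent_monom family_monom_eq_0_iff)
    show "inj_on \<phi> (topspace Y)"
      unfolding topspace
    proof (rule inj_onI)
      fix T T' assume "T \<in> X" "T' \<in> X" "\<phi> T = \<phi> T'"
      then have "{x} \<subseteq> T \<longleftrightarrow> {x} \<subseteq> T'" for x using mem_iff[of _ "{x}"] by simp
      then show "T = T'" by auto
    qed
    show "open_map Y (zariski_spec (family_ring X)) \<phi>"
      unfolding open_map_def
    proof (intro allI impI)
      fix U assume "openin Y U"
      then obtain \<U> where \<U>: "\<And>W. W \<in> \<U> \<Longrightarrow> \<exists>F. finite F \<and> F \<subseteq> V \<and> W = {T \<in> X. F \<subseteq> T}" "U = \<Union>\<U>"
        unfolding Y union_of_def arbitrary_def by auto
      define \<G> where "\<G> = {F. finite F \<and> {T \<in> X. F \<subseteq> T} \<in> \<U>}"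
      have U: "U = (\<Union>F\<in>\<G>. {T \<in> X. F \<subseteq> T})"
        unfolding \<U>(2) \<G>_def using \<U>(1) by blast
      have "family_monom X ` \<G> \<subseteq> carrier (family_ring X)"
        by (auto simp: \<G>_def coherent_monom)
      moreover have "\<phi> ` U = prime_spectrum (family_ring X) -
          {P \<in> prime_spectrum (family_ring X). family_monom X ` \<G> \<subseteq> P}"
      proof -
        have "U = {T \<in> X. \<not> family_monom X ` \<G> \<subseteq> \<phi> T}"
        proof (rule Set.set_eqI)
          fix T
          have "F \<subseteq> T \<longleftrightarrow> family_monom X F \<notin> \<phi> T" if "T \<in> X" "F \<in> \<G>" for F
            using mem_iff that by (simp add: \<G>_def)
          then show "T \<in> U \<longleftrightarrow> T \<in> {T \<in> X. \<not> family_monom X ` \<G> \<subseteq> \<phi> T}"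
            unfolding U by blast
        qed
        moreover have "prime_spectrum (family_ring X) = \<phi> ` X"
          using image by (simp add: topspace topspace_zariski_spec)
        ultimately show ?thesis by blast
      qed
      ultimately show "openin (zariski_spec (family_ring X)) (\<phi> ` U)"
        unfolding openin_zariski_spec by blast
    qed
  qed
  then show ?thesis by (rule homeomorphic_map_imp_homeomorphic_space)
qed

text \<open>
  \<open>V\<close> is the generic point of the space: all other values of a family are specializations of its value
  at \<open>V\<close>, and specializations are unique.
\<close>

lemma inj_on_generic_value:
  assumes "inj code"
  shows "inj_on (\<lambda>f. code (f V)) (carrier (family_ring X))"
proof (rule inj_onI)
  fix f g assume f: "f \<in> carrier (family_ring X)" and g: "g \<in> carrier (family_ring X)"
    and "code (f V) = code (g V)"
  then have eq: "f V = g V" using assms by (simp add: inj_eq)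
  show "f = g"
  proof
    fix T
    show "f T = g T"
    proof (cases "T \<in> X")
      case True
      then have "specializes T (f V) (f T)" "specializes T (g V) (g T)"
        using f g top subset[OF True] by (simp_all add: coherent_family_def)
      then show ?thesis using eq specializes_unique by metis
    qed (use f g in \<open>simp add: coherent_family_def\<close>)
  qed
qed

text \<open>
  Ordered by inclusion, \<open>X\<close> is an algebraic lattice and \<open>Y\<close> carries its Scott topology. The code of
  the value at \<open>V\<close> moves the ring of coherent families into the type of the definition.
\<close>

theorem spectral:
  assumes "openin Y = arbitrary union_of (\<lambda>U. \<exists>F. finite F \<and> F \<subseteq> V \<and> U = {T \<in> X. F \<subseteq> T})"
  shows "spectral_space Y"
proof -
  obtain code :: "'v polyfun fract \<Rightarrow> (nat \<times> 'v set) set" where "inj code"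
    by (rule fract_code)
  note inj = inj_on_generic_value[OF this]
  define R where "R = image_ring (\<lambda>f. code (f V)) (family_ring X)"
  interpret cring "family_ring X" by (rule cring_family_ring)
  have iso: "(\<lambda>f. code (f V)) \<in> ring_iso (family_ring X) R"
    unfolding R_def using inj by (rule inj_imp_image_ring_iso)
  have "cring R"
    using ring_iso_imp_img_cring[OF iso] by (simp add: R_def image_ring_def image_group_def monoid.defs)
  then have "Y homeomorphic_space zariski_spec R"
    using homeomorphic_space_trans[OF homeomorphic_spec_family_ring[OF assms]
        ring_iso_imp_homeomorphic_spec[OF cring_family_ring _ iso]] by blast
  then show ?thesis
    unfolding spectral_space_def using \<open>cring R\<close> by blast
qed

end

section \<open>Sublocalizations form an algebraic closure system\<close>

text \<open>
  Zorn's lemma on the proper filters below \<open>F\<close>, ordered by refinement.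
\<close>

lemma exists_ultrafilter:
  assumes "F \<noteq> bot"
  obtains U :: "'a filter" where "U \<le> F" "U \<noteq> bot" "\<And>P. eventually P U \<or> eventually (\<lambda>x. \<not> P x) U"
proof -
  define \<A> where "\<A> = {U :: 'a filter. U \<le> F \<and> U \<noteq> bot}"
  have "\<exists>M\<in>\<A>. \<forall>U\<in>\<A>. M \<ge> U \<longrightarrow> U = M"
  proof (rule predicate_Zorn)
    show "partial_order_on \<A> (relation_of (\<ge>) \<A>)"
      by (rule partial_order_on_relation_ofI) auto
  next
    fix \<C> assume \<C>: "\<C> \<in> Chains (relation_of (\<ge>) \<A>)"
    then have sub: "\<C> \<subseteq> \<A>" and chain: "\<And>a b. a \<in> \<C> \<Longrightarrow> b \<in> \<C> \<Longrightarrow> a \<le> b \<or> b \<le> a"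
      by (auto simp: Chains_def relation_of_def)
    show "\<exists>u\<in>\<A>. \<forall>a\<in>\<C>. u \<le> a"
    proof (cases "\<C> = {}")
      case True
      then show ?thesis using assms by (auto simp: \<A>_def)
    next
      case False
      have "eventually P (Inf \<C>) \<longleftrightarrow> (\<exists>b\<in>\<C>. eventually P b)" for P
        using False by (rule eventually_Inf_base) (use chain in \<open>metis inf.absorb1 inf.absorb2 order_refl\<close>)
      then have "Inf \<C> \<noteq> bot"
        using sub by (auto simp: trivial_limit_def \<A>_def)
      moreover have "Inf \<C> \<le> F"
        using False sub by (auto simp: \<A>_def intro: Inf_lower2)
      ultimately show ?thesis by (auto simp: \<A>_def intro!: bexI[of _ "Inf \<C>"] Inf_lower)
    qed
  qed
  then obtain U where U: "U \<le> F" "U \<noteq> bot" "\<And>W. W \<le> F \<Longrightarrow> W \<noteq> bot \<Longrightarrow> W \<le> U \<Longrightarrow> W = U"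
    by (auto simp: \<A>_def)
  show ?thesis
  proof (rule that[OF U(1,2)])
    fix P
    show "eventually P U \<or> eventually (\<lambda>x. \<not> P x) U"
    proof (cases "inf U (principal {x. P x}) = bot")
      case True
      then show ?thesis
        by (auto simp: trivial_limit_def eventually_inf_principal)
    next
      case False
      then have "inf U (principal {x. P x}) = U"
        using U(1) by (intro U(3)) (auto intro: le_infI1)
      moreover have "eventually P (inf U (principal {x. P x}))"
        by (simp add: eventually_inf_principal)
      ultimately show ?thesis by simp
    qed
  qed
qed

lemma (in cring) radical_subset_primeideal_iff:
  assumes P: "primeideal P R" and I: "I \<subseteq> carrier R"
  shows "radical R I \<subseteq> P \<longleftrightarrow> I \<subseteq> P"
proof
  interpret primeideal P R by (rule P)
  assume "I \<subseteq> P"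
  have pow: "a \<in> P" if "a \<in> carrier R" "a [^] n \<in> P" for a and n :: nat
    using that
  proof (induction n)
    case 0
    then show ?case using I_notcarr one_imp_carrier by simp
  next
    case (Suc n)
    then show ?case using I_prime[of "a [^] n" a] by auto
  qed
  show "radical R I \<subseteq> P"
    unfolding radical_def using pow \<open>I \<subseteq> P\<close> by blast
next
  assume "radical R I \<subseteq> P"
  moreover have "I \<subseteq> radical R I"
  proof
    fix a assume "a \<in> I"
    then show "a \<in> radical R I"
      using I unfolding radical_def by (auto intro!: exI[of _ "1::nat"])
  qed
  ultimately show "I \<subseteq> P" by blast
qed

locale quotient_field =
  fixes K :: "('a, 'b) ring_scheme" (structure) and D :: "'a set"
  assumes is_quotient_field: "is_quotient_field K D"
begin

abbreviation DR where "DR \<equiv> K\<lparr>carrier := D\<rparr>"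

sublocale K: field K
  using is_quotient_field by (simp add: is_quotient_field_def)

lemma subdomain: "subdomain D K"
  using is_quotient_field by (simp add: is_quotient_field_def)

lemma subring: "subring D K"
  using subdomain by (simp add: subdomain_def subcring_def)

lemmas D_closed = subringE[OF subring]

sublocale D: domain DR
  using K.subdomain_iff[OF subringE(1)[OF subring]] subdomain by blast

lemma colon_subset: "colon_ideal K D x \<subseteq> D"
  by (auto simp: colon_ideal_def)

lemma in_localization_iff:
  assumes P: "P \<in> prime_spectrum DR" and x: "x \<in> carrier K"
  shows "x \<in> localization_at K D P \<longleftrightarrow> \<not> colon_ideal K D x \<subseteq> P"
proof -
  interpret P: primeideal P DR using P by (simp add: prime_spectrum_def)
  have zero: "\<zero> \<in> P" using additive_subgroup.zero_closed[OF P.additive_subgroup_axioms] by simp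
  show ?thesis
  proof
    assume "x \<in> localization_at K D P"
    then obtain a s where as: "x = a \<otimes> inv s" "a \<in> D" "s \<in> D" "s \<notin> P"
      by (auto simp: localization_at_def)
    then have "s \<noteq> \<zero>" using zero by auto
    have "s \<in> carrier K" "a \<in> carrier K" using as D_closed(1) by auto
    then have "s \<otimes> x = a"
      unfolding as(1) using K.m_lcomm[of s a "inv s"] K.field_Units \<open>s \<noteq> \<zero>\<close> by simp
    then show "\<not> colon_ideal K D x \<subseteq> P"
      using as by (auto simp: colon_ideal_def)
  next
    assume "\<not> colon_ideal K D x \<subseteq> P"
    then obtain s where s: "s \<in> D" "s \<otimes> x \<in> D" "s \<notin> P" by (auto simp: colon_ideal_def)
    then have "s \<noteq> \<zero>" using zero by auto
    have "s \<in> carrier K" using s D_closed(1) by auto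
    then have "x = (s \<otimes> x) \<otimes> inv s"
      using K.m_comm[of s x] K.m_assoc[of x s "inv s"] K.field_Units \<open>s \<noteq> \<zero>\<close> x by simp
    then show "x \<in> localization_at K D P"
      using s unfolding localization_at_def by blast
  qed
qed

lemma sublocalizationE:
  assumes "T \<in> sublocalizations K D"
  obtains \<Delta> where "\<Delta> \<subseteq> prime_spectrum DR" "T = carrier K \<inter> (\<Inter>P\<in>\<Delta>. localization_at K D P)"
  using assms by (auto simp: sublocalizations_def)

lemma sublocalization_subset: "T \<in> sublocalizations K D \<Longrightarrow> T \<subseteq> carrier K"
  by (erule sublocalizationE) blast

lemma sublocalization_subring: "T \<in> sublocalizations K D \<Longrightarrow> subring T K" "T \<in> sublocalizations K D \<Longrightarrow> D \<subseteq> T"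
  by (auto simp: sublocalizations_def overrings_def)

lemma carrier_sublocalization: "carrier K \<in> sublocalizations K D"
  unfolding sublocalizations_def overrings_def
  using K.carrier_is_subring D_closed(1) by (auto intro!: exI[of _ "{}"])

lemma Inter_sublocalizations:
  assumes "\<Y> \<noteq> {}" "\<Y> \<subseteq> sublocalizations K D"
  shows "\<Inter>\<Y> \<in> sublocalizations K D"
proof -
  have "\<forall>T\<in>\<Y>. \<exists>\<Delta>. \<Delta> \<subseteq> prime_spectrum DR \<and> T = carrier K \<inter> (\<Inter>P\<in>\<Delta>. localization_at K D P)"
    using assms(2) by (auto simp: sublocalizations_def)
  then obtain \<Delta> where \<Delta>: "\<And>T. T \<in> \<Y> \<Longrightarrow> \<Delta> T \<subseteq> prime_spectrum DR"
      "\<And>T. T \<in> \<Y> \<Longrightarrow> T = carrier K \<inter> (\<Inter>P\<in>\<Delta> T. localization_at K D P)"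
    by metis
  have "\<Inter>\<Y> = (\<Inter>T\<in>\<Y>. carrier K \<inter> (\<Inter>P\<in>\<Delta> T. localization_at K D P))"
    using \<Delta>(2) by auto
  also have "\<dots> = carrier K \<inter> (\<Inter>P\<in>(\<Union>T\<in>\<Y>. \<Delta> T). localization_at K D P)"
    using assms(1) by auto
  finally have "\<Inter>\<Y> = carrier K \<inter> (\<Inter>P\<in>(\<Union>T\<in>\<Y>. \<Delta> T). localization_at K D P)" .
  moreover have "(\<Union>T\<in>\<Y>. \<Delta> T) \<subseteq> prime_spectrum DR" using \<Delta>(1) by blast
  moreover have "\<Inter>\<Y> \<in> overrings K D"
    unfolding overrings_def using assms sublocalization_subring by (auto intro!: K.subring_Inter)
  ultimately show ?thesis unfolding sublocalizations_def by blast
qed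

text \<open>
  A prime contains an ideal iff it contains its radical, so the colon ideal may be replaced by
  the finitely generated ideal that rad-colon coherence provides. For \<open>x \<in> D\<close> the colon ideal is the
  unit ideal and \<open>\<one>\<close> serves as its generator.
\<close>

lemma finite_test_for_colon:
  assumes "rad_colon_coherent K D" "x \<in> carrier K"
  obtains S where "finite S" "S \<subseteq> D"
    "\<And>P. P \<in> prime_spectrum DR \<Longrightarrow> colon_ideal K D x \<subseteq> P \<longleftrightarrow> S \<subseteq> P"
proof (cases "x \<in> D")
  case True
  have "\<one> \<in> colon_ideal K D x"
    using True assms(2) D_closed(3) by (simp add: colon_ideal_def)
  moreover have "\<one> \<notin> P" if "P \<in> prime_spectrum DR" for P
  proof -
    interpret P: primeideal P DR using that by (simp add: prime_spectrum_def)
    show ?thesis using P.I_notcarr P.one_imp_carrier by auto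
  qed
  ultimately show ?thesis
    by (intro that[of "{\<one>}"]) (use D_closed(3) in auto)
next
  case False
  then obtain I where I: "finitely_generated_ideal DR I"
      "radical DR I = radical DR (colon_ideal K D x)"
    using assms unfolding rad_colon_coherent_def by blast
  then obtain S where S: "finite S" "S \<subseteq> D" "I = genideal DR S"
    unfolding finitely_generated_ideal_def by auto
  show ?thesis
  proof (rule that[OF S(1,2)])
    fix P assume "P \<in> prime_spectrum DR"
    then have P: "primeideal P DR" by (simp add: prime_spectrum_def)
    interpret P: primeideal P DR by (rule P)
    interpret I: ideal I DR unfolding S(3) using S(2) by (intro D.genideal_ideal) simp
    have "colon_ideal K D x \<subseteq> P \<longleftrightarrow> radical DR (colon_ideal K D x) \<subseteq> P"
      using D.radical_subset_primeideal_iff[OF P] colon_subset by simp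
    also have "\<dots> \<longleftrightarrow> I \<subseteq> P"
      unfolding I(2)[symmetric] using D.radical_subset_primeideal_iff[OF P] I.a_subset by simp
    also have "\<dots> \<longleftrightarrow> S \<subseteq> P"
      unfolding S(3) using D.genideal_minimal[OF P.is_ideal] D.genideal_self[of S] S(2) by auto
    finally show "colon_ideal K D x \<subseteq> P \<longleftrightarrow> S \<subseteq> P" .
  qed
qed

text \<open>
  Membership of an element in almost all of the primes commutes with the Boolean connectives, by the
  ultrafilter property, and being prime is expressed by first-order conditions on elements.
\<close>

lemma ultraproduct_prime:
  assumes U: "U \<noteq> bot" "\<And>A. eventually A U \<or> eventually (\<lambda>i. \<not> A i) U"
    and P: "\<forall>\<^sub>F i in U. P i \<in> prime_spectrum DR"
  shows "{d \<in> D. \<forall>\<^sub>F i in U. d \<in> P i} \<in> prime_spectrum DR" (is "?Q \<in> _")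
proof -
  have ideal_rules: "\<zero> \<in> p" "\<And>a b. a \<in> p \<Longrightarrow> b \<in> p \<Longrightarrow> a \<oplus> b \<in> p" "\<And>a. a \<in> p \<Longrightarrow> \<ominus>\<^bsub>DR\<^esub> a \<in> p"
    "\<And>a b. a \<in> p \<Longrightarrow> b \<in> D \<Longrightarrow> b \<otimes> a \<in> p"
    "\<And>a b. a \<in> D \<Longrightarrow> b \<in> D \<Longrightarrow> a \<otimes> b \<in> p \<Longrightarrow> a \<in> p \<or> b \<in> p" "\<one> \<notin> p"
    if "p \<in> prime_spectrum DR" for p
  proof -
    interpret p: primeideal p DR using that by (simp add: prime_spectrum_def)
    note add = p.additive_subgroup_axioms
    show "\<zero> \<in> p" using additive_subgroup.zero_closed[OF add] by simp
    show "a \<oplus> b \<in> p" if "a \<in> p" "b \<in> p" for a b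
      using additive_subgroup.a_closed[OF add that] by simp
    show "\<ominus>\<^bsub>DR\<^esub> a \<in> p" if "a \<in> p" for a
      using additive_subgroup.a_inv_closed[OF add that] .
    show "b \<otimes> a \<in> p" if "a \<in> p" "b \<in> D" for a b
      using p.I_l_closed[of a b] that by simp
    show "a \<in> p \<or> b \<in> p" if "a \<in> D" "b \<in> D" "a \<otimes> b \<in> p" for a b
      using p.I_prime[of a b] that by simp
    show "\<one> \<notin> p" using p.I_notcarr p.one_imp_carrier by auto
  qed
  have sub: "subgroup ?Q (add_monoid DR)"
  proof (rule D.add.subgroupI)
    show "?Q \<subseteq> carrier DR" by auto
    have "\<forall>\<^sub>F i in U. \<zero> \<in> P i" using P by eventually_elim (rule ideal_rules)
    then show "?Q \<noteq> {}" using D_closed(2) by blast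
    show "\<ominus>\<^bsub>DR\<^esub> a \<in> ?Q" if "a \<in> ?Q" for a
    proof -
      have "\<forall>\<^sub>F i in U. a \<in> P i" using that by simp
      with P have "\<forall>\<^sub>F i in U. \<ominus>\<^bsub>DR\<^esub> a \<in> P i" by eventually_elim (rule ideal_rules)
      then show ?thesis using that D.a_inv_closed[of a] by simp
    qed
    show "a \<oplus>\<^bsub>DR\<^esub> b \<in> ?Q" if "a \<in> ?Q" "b \<in> ?Q" for a b
    proof -
      have "\<forall>\<^sub>F i in U. a \<in> P i" "\<forall>\<^sub>F i in U. b \<in> P i" using that by simp_all
      with P have "\<forall>\<^sub>F i in U. a \<oplus> b \<in> P i" by eventually_elim (rule ideal_rules)
      then show ?thesis using that D.a_closed[of a b] by simp
    qed
  qed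
  have absorb: "b \<otimes> a \<in> ?Q" if "a \<in> ?Q" "b \<in> D" for a b
  proof -
    have "\<forall>\<^sub>F i in U. a \<in> P i" using that by simp
    with P have "\<forall>\<^sub>F i in U. b \<otimes> a \<in> P i" by eventually_elim (rule ideal_rules(4), use that in auto)
    then show ?thesis using that D.m_closed[of b a] by simp
  qed
  have ideal: "ideal ?Q DR"
  proof (rule idealI[OF D.ring_axioms sub])
    fix a x assume a: "a \<in> ?Q" "x \<in> carrier DR"
    show "x \<otimes>\<^bsub>DR\<^esub> a \<in> ?Q" using absorb a by simp
    then show "a \<otimes>\<^bsub>DR\<^esub> x \<in> ?Q" using D.m_comm[of x a] a by simp
  qed
  have "primeideal ?Q DR"
  proof (rule primeidealI[OF ideal D.is_cring])
    have "\<forall>\<^sub>F i in U. \<one> \<notin> P i" using P by eventually_elim (rule ideal_rules)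
    have "\<one> \<notin> ?Q"
    proof
      assume "\<one> \<in> ?Q"
      then have "\<forall>\<^sub>F i in U. \<one> \<in> P i" by simp
      with \<open>\<forall>\<^sub>F i in U. \<one> \<notin> P i\<close> have "\<forall>\<^sub>F i in U. False"
        by eventually_elim simp
      then show False using U(1) by (simp add: trivial_limit_def)
    qed
    then show "carrier DR \<noteq> ?Q" using D_closed(3) by auto
    fix a b assume ab: "a \<in> carrier DR" "b \<in> carrier DR" "a \<otimes>\<^bsub>DR\<^esub> b \<in> ?Q"
    then have "\<forall>\<^sub>F i in U. a \<otimes> b \<in> P i" by simp
    show "a \<in> ?Q \<or> b \<in> ?Q"
    proof (cases "\<forall>\<^sub>F i in U. a \<in> P i")
      case False
      then have "\<forall>\<^sub>F i in U. a \<notin> P i" using U(2) by blast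
      with P \<open>\<forall>\<^sub>F i in U. a \<otimes> b \<in> P i\<close> have "\<forall>\<^sub>F i in U. b \<in> P i"
        by eventually_elim (use ideal_rules(5) ab in auto)
      then show ?thesis using ab by simp
    qed (use ab in simp)
  qed
  then show ?thesis by (simp add: prime_spectrum_def)
qed

text \<open>
  For \<open>y\<close> outside \<open>T\<close>, every finite \<open>F \<subseteq> T\<close> has a prime \<open>P F\<close> whose localization contains \<open>F\<close> but
  not \<open>y\<close>. Let \<open>Q\<close> be the ultraproduct of these primes along the finite subsets of \<open>T\<close>. The colon
  ideal of \<open>y\<close> lies in every \<open>P F\<close>, hence in \<open>Q\<close>. For \<open>x \<in> T\<close>, almost every \<open>P F\<close> misses some
  element of the finite test set of \<open>x\<close>, and because this set is finite, \<open>Q\<close> misses one of them as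
  well. So \<open>D\<^sub>Q\<close> contains \<open>T\<close> but not \<open>y\<close>. The closure of a finite set is itself a sublocalization,
  hence a ring, which makes \<open>T\<close> an overring.
\<close>

lemma finitary_sublocalizations:
  assumes coh: "rad_colon_coherent K D" and T: "T \<subseteq> carrier K"
    and fin: "\<And>F. finite F \<Longrightarrow> F \<subseteq> T \<Longrightarrow> \<Inter>{Y \<in> sublocalizations K D. F \<subseteq> Y} \<subseteq> T"
  shows "T \<in> sublocalizations K D"
proof -
  define cl where "cl F = \<Inter>{Y \<in> sublocalizations K D. F \<subseteq> Y}" for F
  have cl: "cl F \<in> sublocalizations K D" if "F \<subseteq> T" for F
    unfolding cl_def using that T carrier_sublocalization by (intro Inter_sublocalizations) auto
  have F_cl: "F \<subseteq> cl F" for F unfolding cl_def by blast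
  have cl_T: "cl F \<subseteq> T" if "finite F" "F \<subseteq> T" for F unfolding cl_def by (rule fin[OF that])
  have separate: "\<exists>P\<in>prime_spectrum DR. T \<subseteq> localization_at K D P \<and> y \<notin> localization_at K D P"
    if y: "y \<in> carrier K" "y \<notin> T" for y
  proof -
    have "\<exists>P. P \<in> prime_spectrum DR \<and> F \<subseteq> localization_at K D P \<and> y \<notin> localization_at K D P"
      if F: "finite F" "F \<subseteq> T" for F
    proof -
      obtain \<Delta> where \<Delta>: "\<Delta> \<subseteq> prime_spectrum DR" "cl F = carrier K \<inter> (\<Inter>P\<in>\<Delta>. localization_at K D P)"
        using cl[OF F(2)] by (rule sublocalizationE)
      have "y \<notin> cl F" using cl_T[OF F] y(2) by blast
      then obtain P where "P \<in> \<Delta>" "y \<notin> localization_at K D P" using \<Delta>(2) y(1) by auto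
      moreover have "F \<subseteq> localization_at K D P"
        using F_cl[of F] \<Delta>(2) \<open>P \<in> \<Delta>\<close> by auto
      ultimately show ?thesis using \<Delta>(1) by auto
    qed
    then obtain P where P: "\<And>F. finite F \<Longrightarrow> F \<subseteq> T \<Longrightarrow> P F \<in> prime_spectrum DR"
      "\<And>F. finite F \<Longrightarrow> F \<subseteq> T \<Longrightarrow> F \<subseteq> localization_at K D (P F)"
      "\<And>F. finite F \<Longrightarrow> F \<subseteq> T \<Longrightarrow> y \<notin> localization_at K D (P F)"
      by metis
    obtain U where U: "U \<le> finite_subsets_at_top T" "U \<noteq> bot"
      "\<And>A. eventually A U \<or> eventually (\<lambda>F. \<not> A F) U"
      using exists_ultrafilter[OF finite_subsets_at_top_neq_bot] by metis
    have U_ev: "\<forall>\<^sub>F F in U. finite F \<and> G \<subseteq> F \<and> F \<subseteq> T" if "finite G" "G \<subseteq> T" for G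
    proof (rule filter_leD[OF U(1)])
      show "\<forall>\<^sub>F F in finite_subsets_at_top T. finite F \<and> G \<subseteq> F \<and> F \<subseteq> T"
        unfolding eventually_finite_subsets_at_top using that by blast
    qed
    define Q where "Q = {d \<in> D. \<forall>\<^sub>F F in U. d \<in> P F}"
    have Q: "Q \<in> prime_spectrum DR"
      unfolding Q_def
    proof (rule ultraproduct_prime[OF U(2,3)])
      show "\<forall>\<^sub>F F in U. P F \<in> prime_spectrum DR"
        using U_ev[of "{}"] by (simp, elim eventually_mono) (auto intro: P(1))
    qed
    have "x \<in> localization_at K D Q" if x: "x \<in> T" for x
    proof -
      have xK: "x \<in> carrier K" using x T by blast
      obtain S where S: "finite S" "S \<subseteq> D"
        "\<And>P. P \<in> prime_spectrum DR \<Longrightarrow> colon_ideal K D x \<subseteq> P \<longleftrightarrow> S \<subseteq> P"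
        using finite_test_for_colon[OF coh xK] by metis
      have "\<not> S \<subseteq> Q"
      proof
        assume "S \<subseteq> Q"
        then have "\<forall>\<^sub>F F in U. \<forall>s\<in>S. s \<in> P F"
          by (intro eventually_ball_finite[OF S(1)]) (auto simp: Q_def)
        moreover have "\<forall>\<^sub>F F in U. finite F \<and> {x} \<subseteq> F \<and> F \<subseteq> T" using U_ev[of "{x}"] x by simp
        ultimately have "\<forall>\<^sub>F F in U. False"
        proof eventually_elim
          case (elim F)
          then have F: "finite F" "F \<subseteq> T" "x \<in> F" by auto
          then have "x \<in> localization_at K D (P F)" using P(2) by blast
          then show False
            using in_localization_iff[OF P(1)[OF F(1,2)] xK] S(3)[OF P(1)[OF F(1,2)]] elim by blast
        qed
        then show False using U(2) by (simp add: trivial_limit_def)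
      qed
      then show ?thesis using in_localization_iff[OF Q xK] S(3)[OF Q] by blast
    qed
    moreover have "y \<notin> localization_at K D Q"
    proof -
      have "colon_ideal K D y \<subseteq> Q"
      proof
        fix d assume d: "d \<in> colon_ideal K D y"
        have "\<forall>\<^sub>F F in U. finite F \<and> {} \<subseteq> F \<and> F \<subseteq> T" by (rule U_ev) auto
        then have "\<forall>\<^sub>F F in U. d \<in> P F"
        proof eventually_elim
          case (elim F)
          then show ?case
            using in_localization_iff[OF P(1) y(1), of F] P(3)[of F] d by blast
        qed
        then show "d \<in> Q" using d by (simp add: Q_def colon_ideal_def)
      qed
      then show ?thesis using in_localization_iff[OF Q y(1)] by blast
    qed
    ultimately show ?thesis using Q by blast
  qed
  define \<Delta> where "\<Delta> = {P \<in> prime_spectrum DR. T \<subseteq> localization_at K D P}"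
  have "T = carrier K \<inter> (\<Inter>P\<in>\<Delta>. localization_at K D P)"
  proof
    show "T \<subseteq> carrier K \<inter> (\<Inter>P\<in>\<Delta>. localization_at K D P)"
      using T unfolding \<Delta>_def by auto
    show "carrier K \<inter> (\<Inter>P\<in>\<Delta>. localization_at K D P) \<subseteq> T"
      using separate unfolding \<Delta>_def by blast
  qed
  moreover have "\<Delta> \<subseteq> prime_spectrum DR" by (auto simp: \<Delta>_def)
  moreover have "T \<in> overrings K D"
  proof -
    have clos: "z \<in> T" if "F \<subseteq> T" "finite F" "z \<in> cl F" for F z using cl_T that by blast
    have "subring T K"
    proof (rule K.subringI[OF T])
      show "\<one> \<in> T" using clos[of "{}"] subringE(3)[OF sublocalization_subring(1)[OF cl[of "{}"]]] by simp
      show "\<ominus> a \<in> T" if "a \<in> T" for a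
      proof (rule clos[of "{a}"])
        show "\<ominus> a \<in> cl {a}"
          using subringE(5)[OF sublocalization_subring(1)[OF cl[of "{a}"]]] F_cl[of "{a}"] that by auto
      qed (use that in auto)
      show "a \<otimes> b \<in> T" if "a \<in> T" "b \<in> T" for a b
      proof (rule clos[of "{a, b}"])
        show "a \<otimes> b \<in> cl {a, b}"
          using subringE(6)[OF sublocalization_subring(1)[OF cl[of "{a, b}"]]] F_cl[of "{a, b}"] that by auto
      qed (use that in auto)
      show "a \<oplus> b \<in> T" if "a \<in> T" "b \<in> T" for a b
      proof (rule clos[of "{a, b}"])
        show "a \<oplus> b \<in> cl {a, b}"
          using subringE(7)[OF sublocalization_subring(1)[OF cl[of "{a, b}"]]] F_cl[of "{a, b}"] that by auto
      qed (use that in auto)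
    qed
    moreover have "D \<subseteq> T"
      using sublocalization_subring(2)[OF cl[of "{}"]] cl_T[of "{}"] by auto
    ultimately show ?thesis by (simp add: overrings_def)
  qed
  ultimately show ?thesis unfolding sublocalizations_def by blast
qed

end

section \<open>The space of sublocalizations is spectral\<close>

theorem theorem5p5:
  fixes K :: "('a, 'b) ring_scheme" and D :: "'a set"
  assumes "is_quotient_field K D"
    and "rad_colon_coherent K D"
  shows "spectral_space (subtopology (zariski_over K D) (sublocalizations K D))"
proof -
  interpret quotient_field K D
    by unfold_locales (rule assms(1))
  interpret algebraic_closure_system "carrier K" "sublocalizations K D"
    by unfold_locales
      (rule sublocalization_subset carrier_sublocalization Inter_sublocalizations
        finitary_sublocalizations[OF assms(2)]; assumption)+
  have basic: "sublocalizations K D \<inter> overring_basic K D F = {T \<in> sublocalizations K D. F \<subseteq> T}" for F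
    by (auto simp: overring_basic_def sublocalizations_def)
  have "openin (subtopology (zariski_over K D) (sublocalizations K D)) =
      arbitrary union_of ((\<lambda>U. \<exists>F. finite F \<and> F \<subseteq> carrier K \<and> U = overring_basic K D F)
        relative_to sublocalizations K D)"
    by (simp flip: openin_relative_to arbitrary_union_of_relative_to openin_zariski_over)
  also have "(\<lambda>U. \<exists>F. finite F \<and> F \<subseteq> carrier K \<and> U = overring_basic K D F)
        relative_to sublocalizations K D =
      (\<lambda>U. \<exists>F. finite F \<and> F \<subseteq> carrier K \<and> U = {T \<in> sublocalizations K D. F \<subseteq> T})"
    unfolding relative_to_def basic[symmetric] by blast
  finally show ?thesis by (rule spectral)
qed

end
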